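(* Let $\Lambda^\vee$ be a lattice with an even symmetric bilinear form $I$, and fix $\tau\in\mathbb C$ with $\operatorname{im}(\tau)>0$. Let $\mathbf L^I$ be the topological complex line bundle on $T\times T$ and $\mathcal L_{Lo}(I)$ the Looijenga line bundle on $T_{\mathbb C}/q^{\Lambda^\vee}$ (both defined in the context), where the base spaces are identified via the map induced by $\mathfrak t\times\mathfrak t\to\mathfrak t_{\mathbb C}$, $(x,y)\mapsto\tau x+y$. Then there is an isomorphism of (topological complex) line bundles $$\mathbf L^I\longrightarrow\mathcal L_{Lo}(I).$$
   Context: $\mathfrak t=\Lambda^\vee\otimes\mathbb R$, $\mathfrak t_{\mathbb C}=\Lambda^\vee\otimes\mathbb C$, $T=\Lambda^\vee\otimes U(1)\cong\mathfrak t/\Lambda^\vee$, $T_{\mathbb C}=\Lambda^\vee\otimes\mathbb C^\times$, with $\exp=\Lambda^\vee\otimes e^{2\pi i(-)}$. $I$ is extended bilinearly. $\Lambda=\operatorname{Hom}(\Lambda^\vee,\mathbb Z)$, $I^\sharp(m)=I(m,-)\in\Lambda$, and for $\lambda\in\Lambda$, $e^{2\pi i\lambda}$ is the corresponding character of $T_{\mathbb C}$. Put $q=e^{2\pi i\tau}$; for $x\in\mathfrak t$, $q^x=\exp(\tau x)\in T_{\mathbb C}$, and for a real number $r$, $q^r=e^{2\pi i\tau r}$. **$\mathbf L^I$.** Let $P$ be the principal $U(1)$-bundle $P=(\mathfrak t\times T\times U(1))/\sim$ over $T\times T$, with $(x+m,s,z)\sim(x,s,z\cdot e^{2\pi iI(m,y)})$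 for $m\in\Lambda^\vee$, where $y\in\mathfrak t$ is any element with $\exp(y)=s$; the projection is $[x,s,z]\mapsto(\exp(x),s)$. $\mathbf L^I$ is the complex line bundle associated to $P$ (replace $U(1)$ by $\mathbb C$). **Looijenga line bundle.** Over $T_{\mathbb C}/q^{\Lambda^\vee}\cong\mathfrak t_{\mathbb C}/(\tau\Lambda^\vee+\Lambda^\vee)$, $\mathcal L_{Lo}(I)=(T_{\mathbb C}\times\mathbb C)/\sim$ with $$(h,c)\sim\left(hq^m,\ c\,e^{-2\pi iI^\sharp(m)}(h)\cdot q^{-\frac12I(m,m)}\right),\qquad m\in\Lambda^\vee.$$ *)

theory Defs
  imports "HOL-Analysis.Analysis" "HOL-Algebra.Free_Abelian_Groups"
begin

definition additive_group :: "'a::ab_group_add monoid" where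
  "additive_group = \<lparr>carrier = UNIV, monoid.mult = (+), one = 0\<rparr>"

definition circle_group :: "complex monoid" where
  "circle_group = \<lparr>carrier = sphere 0 1, monoid.mult = (*), one = 1\<rparr>"

definition Cstar_group :: "complex monoid" where
  "Cstar_group = \<lparr>carrier = UNIV - {0}, monoid.mult = (*), one = 1\<rparr>"

text \<open>A lattice is a free abelian group of finite rank (possibly 0).\<close>

definition is_lattice :: "('l, 'r) monoid_scheme \<Rightarrow> bool" where
  "is_lattice L \<longleftrightarrow> (\<exists>S::nat set. finite S \<and> L \<cong> free_Abelian_group S)"

definition dual_lattice :: "('l::ab_group_add \<Rightarrow> int) set" where
  "dual_lattice = {l. Modules.additive l}"

definition even_symmetric_form :: "('l::ab_group_add \<Rightarrow> 'l \<Rightarrow> int) \<Rightarrow> bool" where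
  "even_symmetric_form I \<longleftrightarrow>
     (\<forall>m. I m \<in> dual_lattice) \<and> (\<forall>m n. I m n = I n m) \<and> (\<forall>m. even (I m m))"

text \<open>
  The tensor product over the integers of the abelian group \<open>'l\<close> with an abelian group \<open>A\<close>:
  the free abelian group on pairs modulo the bilinearity relations. Its elements are cosets,
  i.e. sets of formal integer combinations of pairs.
\<close>

type_synonym ('l, 'a) tensor = "('l \<times> 'a \<Rightarrow>\<^sub>0 int) set"

definition tensor_relators :: "('a, 'r) monoid_scheme \<Rightarrow> ('l::ab_group_add \<times> 'a \<Rightarrow>\<^sub>0 int) set" where
  "tensor_relators A =
     {frag_of (m + n, a) - frag_of (m, a) - frag_of (n, a) | m n a. a \<in> carrier A} \<union>
     {frag_of (m, a \<otimes>\<^bsub>A\<^esub> b) - frag_of (m, a) - frag_of (m, b) | m a b.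
        a \<in> carrier A \<and> b \<in> carrier A}"

definition tensor_relations :: "('a, 'r) monoid_scheme \<Rightarrow> ('l::ab_group_add \<times> 'a \<Rightarrow>\<^sub>0 int) set" where
  "tensor_relations A = generate (free_Abelian_group (UNIV \<times> carrier A)) (tensor_relators A)"

definition tensor_group :: "('a, 'r) monoid_scheme \<Rightarrow> ('l::ab_group_add, 'a) tensor monoid" where
  "tensor_group A = free_Abelian_group (UNIV \<times> carrier A) Mod tensor_relations A"

definition pure_tensor :: "('a, 'r) monoid_scheme \<Rightarrow> 'l::ab_group_add \<Rightarrow> 'a \<Rightarrow> ('l, 'a) tensor" where
  "pure_tensor A m a =
     tensor_relations A #>\<^bsub>free_Abelian_group (UNIV \<times> carrier A)\<^esub> frag_of (m, a)"

text \<open>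
  The homomorphism from the tensor product to the abelian group \<open>G\<close> that sends the pure tensor of
  \<open>m\<close> and \<open>a\<close> to \<open>f m a\<close>. It is used only for bilinear \<open>f\<close>, where the value does not depend on the
  representative \<open>c\<close>.
\<close>

definition tensor_lift ::
  "('g, 'r) monoid_scheme \<Rightarrow> ('l \<Rightarrow> 'a \<Rightarrow> 'g) \<Rightarrow> ('l, 'a) tensor \<Rightarrow> 'g" where
  "tensor_lift G f X =
     (let c = SOME c. c \<in> X
      in finprod G (\<lambda>(m, a). f m a [^]\<^bsub>G\<^esub> Poly_Mapping.lookup c (m, a)) (Poly_Mapping.keys c))"

definition tensor_map ::
  "('b, 'r) monoid_scheme \<Rightarrow> ('a \<Rightarrow> 'b) \<Rightarrow> ('l::ab_group_add, 'a) tensor \<Rightarrow> ('l, 'b) tensor" where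
  "tensor_map B f = tensor_lift (tensor_group B) (\<lambda>m a. pure_tensor B m (f a))"

text \<open>The map to \<open>A\<close> induced by \<open>l\<close> in the dual lattice. For \<open>A = Cstar_group\<close> it is the
  character \<open>exp (2\<pi>il)\<close> of the complex torus.\<close>

definition tensor_eval ::
  "('a, 'r) monoid_scheme \<Rightarrow> ('l \<Rightarrow> int) \<Rightarrow> ('l, 'a) tensor \<Rightarrow> 'a" where
  "tensor_eval A l = tensor_lift A (\<lambda>m a. a [^]\<^bsub>A\<^esub> l m)"

text \<open>
  For a lattice and \<open>A\<close> with its subspace topology, this is the topology obtained
  from any identification of the tensor product with \<open>A\<^sup>n\<close> by a basis: the coarsest one making the
  maps induced by the elements of the dual lattice continuous.
\<close>

definition tensor_topology ::
  "('a::topological_space, 'r) monoid_scheme \<Rightarrow> ('l::ab_group_add, 'a) tensor topology" where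
  "tensor_topology A =
     pullback_topology (carrier (tensor_group A))
       (\<lambda>X. \<lambda>l\<in>dual_lattice. tensor_eval A l X)
       (product_topology (\<lambda>_. top_of_set (carrier A)) dual_lattice)"

definition e2pii :: "complex \<Rightarrow> complex" where
  "e2pii z = exp (2 * of_real pi * \<i> * z)"

definition t_group :: "('l::ab_group_add, real) tensor monoid" where
  "t_group = tensor_group additive_group"

definition tC_group :: "('l::ab_group_add, complex) tensor monoid" where
  "tC_group = tensor_group additive_group"

definition T_group :: "('l::ab_group_add, complex) tensor monoid" where
  "T_group = tensor_group circle_group"

definition TC_group :: "('l::ab_group_add, complex) tensor monoid" where
  "TC_group = tensor_group Cstar_group"

definition t_top :: "('l::ab_group_add, real) tensor topology" where
  "t_top = tensor_topology additive_group"

definition T_top :: "('l::ab_group_add, complex) tensor topology" where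
  "T_top = tensor_topology circle_group"

definition TC_top :: "('l::ab_group_add, complex) tensor topology" where
  "TC_top = tensor_topology Cstar_group"

text \<open>The inclusion of the lattice into the real vector space it spans.\<close>

definition in_t :: "'l::ab_group_add \<Rightarrow> ('l, real) tensor" where
  "in_t m = pure_tensor additive_group m 1"

definition exp_T :: "('l::ab_group_add, real) tensor \<Rightarrow> ('l, complex) tensor" where
  "exp_T = tensor_map circle_group (\<lambda>r. e2pii (of_real r))"

definition exp_TC :: "('l::ab_group_add, complex) tensor \<Rightarrow> ('l, complex) tensor" where
  "exp_TC = tensor_map Cstar_group e2pii"

text \<open>The product \<open>z x\<close> in the complexification of a complex number \<open>z\<close> and a real vector \<open>x\<close>.\<close>

definition cscale :: "complex \<Rightarrow> ('l::ab_group_add, real) tensor \<Rightarrow> ('l, complex) tensor" where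
  "cscale z = tensor_map additive_group (\<lambda>r. z * of_real r)"

definition q_pow :: "complex \<Rightarrow> ('l::ab_group_add, real) tensor \<Rightarrow> ('l, complex) tensor" where
  "q_pow \<tau> x = exp_TC (cscale \<tau> x)"

definition q_powr :: "complex \<Rightarrow> real \<Rightarrow> complex" where
  "q_powr \<tau> r = e2pii (\<tau> * of_real r)"

text \<open>The real bilinear extension of the form \<open>I\<close>.\<close>

definition form_ext ::
  "('l::ab_group_add \<Rightarrow> 'l \<Rightarrow> int) \<Rightarrow> ('l, real) tensor \<Rightarrow> ('l, real) tensor \<Rightarrow> real" where
  "form_ext I x y =
     tensor_lift additive_group
       (\<lambda>m a. a * tensor_lift additive_group (\<lambda>n b. b * of_int (I m n)) y) x"

record ('b, 'e) line_bundle =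
  base :: "'b topology"
  total :: "'e topology"
  proj :: "'e \<Rightarrow> 'b"
  fibre_add :: "'e \<Rightarrow> 'e \<Rightarrow> 'e"
  fibre_scale :: "complex \<Rightarrow> 'e \<Rightarrow> 'e"

text \<open>The trivializations are linear isomorphisms on fibres, so they also force the
  fibrewise operations to satisfy the vector space axioms.\<close>

definition complex_line_bundle :: "('b, 'e) line_bundle \<Rightarrow> bool" where
  "complex_line_bundle E \<longleftrightarrow>
     continuous_map (total E) (base E) (proj E) \<and>
     (\<forall>p\<in>topspace (base E). \<exists>U \<psi>. openin (base E) U \<and> p \<in> U \<and>
        homeomorphic_map (prod_topology (subtopology (base E) U) euclidean)
          (subtopology (total E) {e \<in> topspace (total E). proj E e \<in> U}) \<psi> \<and>
        (\<forall>u\<in>U. \<forall>z w. proj E (\<psi> (u, z)) = u \<and>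
           fibre_add E (\<psi> (u, z)) (\<psi> (u, w)) = \<psi> (u, z + w) \<and>
           fibre_scale E w (\<psi> (u, z)) = \<psi> (u, w * z)))"

definition line_bundle_iso_over ::
  "('b \<Rightarrow> 'c) \<Rightarrow> ('b, 'e) line_bundle \<Rightarrow> ('c, 'f) line_bundle \<Rightarrow> ('e \<Rightarrow> 'f) \<Rightarrow> bool" where
  "line_bundle_iso_over \<beta> E F \<phi> \<longleftrightarrow>
     complex_line_bundle E \<and> complex_line_bundle F \<and>
     homeomorphic_map (base E) (base F) \<beta> \<and>
     homeomorphic_map (total E) (total F) \<phi> \<and>
     (\<forall>e\<in>topspace (total E). proj F (\<phi> e) = \<beta> (proj E e)) \<and>
     (\<forall>e\<in>topspace (total E). \<forall>e'\<in>topspace (total E). proj E e = proj E e' \<longrightarrow>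
        \<phi> (fibre_add E e e') = fibre_add F (\<phi> e) (\<phi> e')) \<and>
     (\<forall>e\<in>topspace (total E). \<forall>w. \<phi> (fibre_scale E w e) = fibre_scale F w (\<phi> e))"

definition quotient_topology :: "'a topology \<Rightarrow> 'a rel \<Rightarrow> 'a set topology" where
  "quotient_topology X R =
     topology (\<lambda>V. V \<subseteq> topspace X // R \<and> openin X {x \<in> topspace X. R `` {x} \<in> V})"

lemma istopology_quotient:
  "istopology (\<lambda>V. V \<subseteq> topspace X // R \<and> openin X {x \<in> topspace X. R `` {x} \<in> V})"
  unfolding istopology_def
proof (intro conjI allI impI)
  fix S T
  assume S: "S \<subseteq> topspace X // R \<and> openin X {x \<in> topspace X. R `` {x} \<in> S}"
    and T: "T \<subseteq> topspace X // R \<and> openin X {x \<in> topspace X. R `` {x} \<in> T}"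
  show "S \<inter> T \<subseteq> topspace X // R" using S by blast
  have "{x \<in> topspace X. R `` {x} \<in> S \<inter> T} =
      {x \<in> topspace X. R `` {x} \<in> S} \<inter> {x \<in> topspace X. R `` {x} \<in> T}"
    by blast
  then show "openin X {x \<in> topspace X. R `` {x} \<in> S \<inter> T}"
    using S T by auto
next
  fix K
  assume K: "\<forall>V\<in>K. V \<subseteq> topspace X // R \<and> openin X {x \<in> topspace X. R `` {x} \<in> V}"
  show "\<Union>K \<subseteq> topspace X // R" using K by blast
  have "{x \<in> topspace X. R `` {x} \<in> \<Union>K} = (\<Union>V\<in>K. {x \<in> topspace X. R `` {x} \<in> V})"
    by blast
  then show "openin X {x \<in> topspace X. R `` {x} \<in> \<Union>K}"
    using K by auto
qed

text \<open>
  The quotient of the trivial line bundle over \<open>X\<close> by a fibrewise linear equivalence relation \<open>R\<close>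
  on \<open>X \<times> \<complex>\<close>, where \<open>p\<close> is the projection of \<open>X\<close> to the base \<open>B\<close>. Addition is
  \<open>[v, z] + [v, w] = [v, z + w]\<close> and scaling is \<open>a [v, z] = [v, a z]\<close>.
\<close>

definition quotient_bundle ::
  "'x topology \<Rightarrow> ('x \<times> complex) rel \<Rightarrow> 'b topology \<Rightarrow> ('x \<Rightarrow> 'b) \<Rightarrow> ('b, ('x \<times> complex) set) line_bundle"
  where
  "quotient_bundle X R B p =
     \<lparr>base = B,
      total = quotient_topology (prod_topology X euclidean) R,
      proj = (\<lambda>e. p (fst (SOME vz. vz \<in> e))),
      fibre_add = (\<lambda>e e'. {(v, z + w) | v z w. (v, z) \<in> e \<and> (v, w) \<in> e'}),
      fibre_scale = (\<lambda>a e. {(v, a * z) | v z. (v, z) \<in> e})\<rparr>"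

text \<open>
  The line bundle associated to the principal \<open>U(1)\<close>-bundle \<open>P\<close> is obtained by using \<open>\<complex>\<close> in place of
  \<open>U(1)\<close> in the definition of \<open>P\<close>.
\<close>

definition LI_rel ::
  "('l::ab_group_add \<Rightarrow> 'l \<Rightarrow> int) \<Rightarrow> ((('l, real) tensor \<times> ('l, complex) tensor) \<times> complex) rel" where
  "LI_rel I =
     {(((x \<otimes>\<^bsub>t_group\<^esub> in_t m, s), z), ((x, s), z * e2pii (of_real (form_ext I (in_t m) y)))) |
        x m s y z. x \<in> carrier t_group \<and> s \<in> carrier T_group \<and> y \<in> carrier t_group \<and> exp_T y = s}"

definition LI_bundle ::
  "('l::ab_group_add \<Rightarrow> 'l \<Rightarrow> int) \<Rightarrow>
   (('l, complex) tensor \<times> ('l, complex) tensor,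
    ((('l, real) tensor \<times> ('l, complex) tensor) \<times> complex) set) line_bundle" where
  "LI_bundle I =
     quotient_bundle (prod_topology t_top T_top) (LI_rel I) (prod_topology T_top T_top)
       (\<lambda>(x, s). (exp_T x, s))"

text \<open>The orbit relation of the action of the lattice on the complex torus by \<open>q\<close>-powers.\<close>

definition q_rel :: "complex \<Rightarrow> ('l::ab_group_add, complex) tensor rel" where
  "q_rel \<tau> = {(h, h \<otimes>\<^bsub>TC_group\<^esub> q_pow \<tau> (in_t m)) | h m. h \<in> carrier TC_group}"

definition Lo_rel ::
  "complex \<Rightarrow> ('l::ab_group_add \<Rightarrow> 'l \<Rightarrow> int) \<Rightarrow> (('l, complex) tensor \<times> complex) rel" where
  "Lo_rel \<tau> I =
     {((h, c),
       (h \<otimes>\<^bsub>TC_group\<^esub> q_pow \<tau> (in_t m),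
        c * tensor_eval Cstar_group (\<lambda>n. - I m n) h * q_powr \<tau> (- (1/2) * of_int (I m m)))) |
        h c m. h \<in> carrier TC_group}"

definition Looijenga_bundle ::
  "complex \<Rightarrow> ('l::ab_group_add \<Rightarrow> 'l \<Rightarrow> int) \<Rightarrow>
   (('l, complex) tensor set, (('l, complex) tensor \<times> complex) set) line_bundle" where
  "Looijenga_bundle \<tau> I =
     quotient_bundle TC_top (Lo_rel \<tau> I) (quotient_topology TC_top (q_rel \<tau>))
       (\<lambda>h. q_rel \<tau> `` {h})"

text \<open>\<open>\<beta>\<close> is the map from \<open>T \<times> T\<close> to the quotient of the complex torus by the \<open>q\<close>-powers that is
  induced by \<open>(x, y) \<mapsto> \<tau> x + y\<close>.\<close>

definition induced_base_map ::
  "complex \<Rightarrow> (('l::ab_group_add, complex) tensor \<times> ('l, complex) tensor \<Rightarrow> ('l, complex) tensor set) \<Rightarrow> bool"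
  where
  "induced_base_map \<tau> \<beta> \<longleftrightarrow>
     (\<forall>x\<in>carrier t_group. \<forall>y\<in>carrier t_group.
        \<beta> (exp_T x, exp_T y) =
          q_rel \<tau> `` {exp_TC (cscale \<tau> x \<otimes>\<^bsub>tC_group\<^esub> cscale 1 y)})"

end

theory Submission
  imports Defs
begin

text \<open>
  The isomorphism is \<open>[x, s, z] \<mapsto> [q\<^sup>x s, z q\<^bsup>-I(x,x)/2\<^esup>]\<close>. Because the modulus of \<open>q\<close> is not \<open>1\<close>,
  \<open>(x, s) \<mapsto> q\<^sup>x s\<close> is a homeomorphism from \<open>\<tt> \<times> T\<close> to the complex torus. It turns translation by
  \<open>m\<close> into multiplication by \<open>q\<^sup>m\<close>, and the Gaussian factor converts one automorphy factor into the
  other, by completing the square in \<open>I(x + m, x + m)\<close>. Both line bundles are therefore quotients of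
  the same trivial bundle, and it remains to know that \<open>exp\<close> is an open, locally injective map, which
  makes the quotient locally trivial.
\<close>

text \<open>The Gaussian is forced. Translation from x to x + m carries the factor chi(s) on the
  first side and chi(q^x s) q^(-I(m,m)/2) on the second, where chi is the character of -I(m,-). A
  nowhere zero rescaling g converts one into the other exactly when g(x + m) = g(x) q^(-I(m,x) -
  I(m,m)/2), and q^(-I(x,x)/2) solves this equation.

  The obstacle is the bareness of the spaces: a tensor product is a set of cosets, and its topology
  is known only through the functionals in \<open>dual_lattice\<close>. Equality of elements is
  therefore tested on the finitely many coordinates of a lattice basis, and continuity into such a
  space on all dual functionals. The maps between the spaces are built from homomorphisms of
  coefficient groups, so that evaluation commutes with them.

  On the second side the relation is recognised as the image of the first one, and local triviality
  is carried along the isomorphism instead of being checked on the complex torus.\<close>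

lemma additive_group_simps [simp]:
  "carrier additive_group = UNIV" "a \<otimes>\<^bsub>additive_group\<^esub> b = a + b" "\<one>\<^bsub>additive_group\<^esub> = 0"
  by (simp_all add: additive_group_def)

lemma circle_group_simps [simp]:
  "carrier circle_group = sphere 0 1" "a \<otimes>\<^bsub>circle_group\<^esub> b = a * b" "\<one>\<^bsub>circle_group\<^esub> = 1"
  by (simp_all add: circle_group_def)

lemma Cstar_group_simps [simp]:
  "carrier Cstar_group = UNIV - {0}" "a \<otimes>\<^bsub>Cstar_group\<^esub> b = a * b" "\<one>\<^bsub>Cstar_group\<^esub> = 1"
  by (simp_all add: Cstar_group_def)

lemma comm_group_additive_group [simp]: "comm_group additive_group"
proof (rule comm_groupI)
  fix x :: 'a
  show "\<exists>y\<in>carrier additive_group. y \<otimes>\<^bsub>additive_group\<^esub> x = \<one>\<^bsub>additive_group\<^esub>"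
    by (rule bexI [of _ "- x"]) auto
qed (auto simp: algebra_simps)

lemma comm_group_circle_group [simp]: "comm_group circle_group"
proof (rule comm_groupI)
  fix x
  assume "x \<in> carrier circle_group"
  then show "\<exists>y\<in>carrier circle_group. y \<otimes>\<^bsub>circle_group\<^esub> x = \<one>\<^bsub>circle_group\<^esub>"
    by (intro bexI [of _ "inverse x"]) (auto simp: norm_inverse intro!: left_inverse)
qed (auto simp: norm_mult mult_ac)

lemma comm_group_Cstar_group [simp]: "comm_group Cstar_group"
proof (rule comm_groupI)
  fix x
  assume "x \<in> carrier Cstar_group"
  then show "\<exists>y\<in>carrier Cstar_group. y \<otimes>\<^bsub>Cstar_group\<^esub> x = \<one>\<^bsub>Cstar_group\<^esub>"
    by (intro bexI [of _ "inverse x"]) auto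
qed (auto simp: mult_ac)

section \<open>Homomorphisms and finite products in commutative groups\<close>

lemma hom_finprod:
  assumes h: "h \<in> hom G H" and "comm_group G" "comm_group H" and f: "f \<in> S \<rightarrow> carrier G"
  shows "h (finprod G f S) = finprod H (\<lambda>i. h (f i)) S"
proof -
  interpret G: comm_group G by fact
  interpret H: comm_group H by fact
  have h1: "h \<one>\<^bsub>G\<^esub> = \<one>\<^bsub>H\<^esub>"
    using hom_one [OF h G.is_group H.is_group] .
  show ?thesis
    using f
  \<comment> \<open>Over an infinite index set both products take the default value, the unit, so
    \<open>h1\<close> settles that case together with the empty one.\<close>
  proof (induction S rule: infinite_finite_induct)
    case (insert x F)
    then have "h (finprod G f (insert x F)) = h (f x) \<otimes>\<^bsub>H\<^esub> h (finprod G f F)"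
      using hom_mult [OF h] by (simp add: Pi_iff)
    moreover have "finprod H (\<lambda>i. h (f i)) (insert x F) = h (f x) \<otimes>\<^bsub>H\<^esub> finprod H (\<lambda>i. h (f i)) F"
      using insert hom_in_carrier [OF h] by (intro H.finprod_insert) (auto simp: Pi_iff)
    ultimately show ?case
      using insert by (simp add: Pi_iff)
  qed (use h1 in auto)
qed

lemma hom_mult_fun:
  assumes "comm_group H" "f \<in> hom G H" "g \<in> hom G H"
  shows "(\<lambda>x. f x \<otimes>\<^bsub>H\<^esub> g x) \<in> hom G H"
proof -
  interpret H: comm_group H by fact
  show ?thesis
    using assms hom_in_carrier [OF assms(2)] hom_in_carrier [OF assms(3)]
    by (intro homI) (auto simp: hom_mult H.m_ac)
qed

lemma hom_finprod_fun:
  assumes "comm_group H" "finite S" "\<And>i. i \<in> S \<Longrightarrow> f i \<in> hom G H"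
  shows "(\<lambda>x. finprod H (\<lambda>i. f i x) S) \<in> hom G H"
proof -
  interpret H: comm_group H by fact
  have c: "i \<in> S \<Longrightarrow> x \<in> carrier G \<Longrightarrow> f i x \<in> carrier H" for i x
    using hom_in_carrier [OF assms(3)] by blast
  show ?thesis
  proof (rule homI)
    fix x y
    assume xy: "x \<in> carrier G" "y \<in> carrier G"
    have "finprod H (\<lambda>i. f i (x \<otimes>\<^bsub>G\<^esub> y)) S = finprod H (\<lambda>i. f i x \<otimes>\<^bsub>H\<^esub> f i y) S"
      using xy assms(3) c by (intro H.finprod_cong') (auto simp: hom_mult)
    then show "finprod H (\<lambda>i. f i (x \<otimes>\<^bsub>G\<^esub> y)) S = finprod H (\<lambda>i. f i x) S \<otimes>\<^bsub>H\<^esub> finprod H (\<lambda>i. f i y) S"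
      using xy c by (subst H.finprod_multf [symmetric]) (auto simp: Pi_iff)
  qed (use c in \<open>auto intro!: H.finprod_closed simp: Pi_iff\<close>)
qed

lemma additive_int_pow: "(a::'a::comm_ring_1) [^]\<^bsub>additive_group\<^esub> (k::int) = of_int k * a"
proof -
  interpret A: comm_group "additive_group :: 'a monoid" by simp
  have p: "a [^]\<^bsub>additive_group\<^esub> n = of_nat n * a" for n :: nat
    by (induction n) (auto simp: algebra_simps)
  have "inv\<^bsub>additive_group\<^esub> b = - b" for b :: 'a
    by (rule A.inv_equality) auto
  then show ?thesis
    by (simp add: int_pow_def2 p)
qed

subsection \<open>Tensor products\<close>

lemma tensor_relations_subgroup:
  assumes "comm_group A"
  shows "subgroup (tensor_relations A) (free_Abelian_group (UNIV \<times> carrier A))"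
proof -
  interpret A: comm_group A by fact
  have "tensor_relators A \<subseteq> carrier (free_Abelian_group (UNIV \<times> carrier A))"
    by (fastforce simp: tensor_relators_def dest!: subsetD [OF keys_diff])
  then show ?thesis
    unfolding tensor_relations_def by (rule group.generate_is_subgroup [OF group_free_Abelian_group])
qed

lemma comm_group_tensor_group:
  assumes "comm_group A"
  shows "comm_group (tensor_group A)"
  unfolding tensor_group_def
  by (rule comm_group.abelian_FactGroup [OF abelian_free_Abelian_group tensor_relations_subgroup [OF assms]])

definition tensor_class :: "('a, 'r) monoid_scheme \<Rightarrow> ('l::ab_group_add \<times> 'a \<Rightarrow>\<^sub>0 int) \<Rightarrow> ('l, 'a) tensor" where
  "tensor_class A c = tensor_relations A #>\<^bsub>free_Abelian_group (UNIV \<times> carrier A)\<^esub> c"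

lemma tensor_class_hom:
  assumes "comm_group A"
  shows "tensor_class A \<in> hom (free_Abelian_group (UNIV \<times> carrier A)) (tensor_group A)"
  unfolding tensor_group_def tensor_class_def
  by (intro normal.r_coset_hom_Mod)
    (simp add: comm_group.normal_iff_subgroup abelian_free_Abelian_group tensor_relations_subgroup assms)

lemma carrier_tensor_group:
  "carrier (tensor_group A) = tensor_class A ` carrier (free_Abelian_group (UNIV \<times> carrier A))"
  by (simp add: tensor_group_def carrier_FactGroup tensor_class_def)

lemma pure_tensor_eq_class: "pure_tensor A m a = tensor_class A (frag_of (m, a))"
  by (simp add: pure_tensor_def tensor_class_def)

lemma pure_tensor_closed:
  assumes "a \<in> carrier A"
  shows "pure_tensor A m a \<in> carrier (tensor_group A)"
  using assms by (auto simp: carrier_tensor_group pure_tensor_eq_class)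

lemma tensor_class_relator:
  assumes "comm_group A" "c \<in> tensor_relators A"
  shows "tensor_class A c = \<one>\<^bsub>tensor_group A\<^esub>"
proof -
  have "c \<in> tensor_relations A"
    unfolding tensor_relations_def using assms(2) by (rule generate.incl)
  then show ?thesis
    using subgroup.rcos_const [OF tensor_relations_subgroup [OF assms(1)] group_free_Abelian_group]
    by (simp add: tensor_class_def tensor_group_def)
qed

lemma tensor_class_add:
  assumes "comm_group A" "Poly_Mapping.keys c \<subseteq> UNIV \<times> carrier A" "Poly_Mapping.keys d \<subseteq> UNIV \<times> carrier A"
  shows "tensor_class A (c + d) = tensor_class A c \<otimes>\<^bsub>tensor_group A\<^esub> tensor_class A d"
  using hom_mult [OF tensor_class_hom [OF assms(1)], of c d] assms by simp

text \<open>This is the defining relator with two terms moved across: the generator at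
  \<open>(m + n, a)\<close> is a relator plus the sum of two generators, and
  \<open>tensor_class\<close> sends the relator to the unit.\<close>

lemma pure_tensor_add_left:
  fixes m n :: "'l::ab_group_add" and a :: 'a
  assumes "comm_group A" "a \<in> carrier A"
  shows "pure_tensor A (m + n) a = pure_tensor A m a \<otimes>\<^bsub>tensor_group A\<^esub> pure_tensor A n a"
proof -
  interpret T: comm_group "tensor_group A :: ('l, 'a) tensor monoid" by (rule comm_group_tensor_group) fact
  let ?r = "frag_of (m + n, a) - frag_of (m, a) - frag_of (n, a)"
  have r: "?r \<in> tensor_relators A"
    unfolding tensor_relators_def using assms(2) by blast
  have k: "Poly_Mapping.keys ?r \<subseteq> UNIV \<times> carrier A"
    using assms by (fastforce dest!: subsetD [OF keys_diff])
  have k2: "Poly_Mapping.keys (frag_of (m, a) + frag_of (n, a)) \<subseteq> UNIV \<times> carrier A"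
    using assms by (fastforce dest!: subsetD [OF keys_add])
  have "frag_of (m + n, a) = ?r + (frag_of (m, a) + frag_of (n, a))"
    by simp
  then show ?thesis
    using tensor_class_add [OF assms(1) k k2] tensor_class_add [OF assms(1), of "frag_of (m, a)" "frag_of (n, a)"]
      tensor_class_relator [OF assms(1) r] assms pure_tensor_closed [OF assms(2), of m] pure_tensor_closed [OF assms(2), of n]
    by (simp add: pure_tensor_eq_class)
qed

lemma pure_tensor_add_right:
  fixes m :: "'l::ab_group_add" and a b :: 'a
  assumes "comm_group A" "a \<in> carrier A" "b \<in> carrier A"
  shows "pure_tensor A m (a \<otimes>\<^bsub>A\<^esub> b) = pure_tensor A m a \<otimes>\<^bsub>tensor_group A\<^esub> pure_tensor A m b"
proof -
  interpret A: comm_group A by fact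
  interpret T: comm_group "tensor_group A :: ('l, 'a) tensor monoid" by (rule comm_group_tensor_group) fact
  let ?r = "frag_of (m, a \<otimes>\<^bsub>A\<^esub> b) - frag_of (m, a) - frag_of (m, b)"
  have r: "?r \<in> tensor_relators A"
    unfolding tensor_relators_def using assms by blast
  have k: "Poly_Mapping.keys ?r \<subseteq> UNIV \<times> carrier A"
    using assms by (fastforce dest!: subsetD [OF keys_diff])
  have k2: "Poly_Mapping.keys (frag_of (m, a) + frag_of (m, b)) \<subseteq> UNIV \<times> carrier A"
    using assms by (fastforce dest!: subsetD [OF keys_add])
  have "frag_of (m, a \<otimes>\<^bsub>A\<^esub> b) = ?r + (frag_of (m, a) + frag_of (m, b))"
    by simp
  then show ?thesis
    using tensor_class_add [OF assms(1) k k2] tensor_class_add [OF assms(1), of "frag_of (m, a)" "frag_of (m, b)"]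
      tensor_class_relator [OF assms(1) r] assms pure_tensor_closed [OF assms(2), of m] pure_tensor_closed [OF assms(3), of m]
    by (simp add: pure_tensor_eq_class)
qed

text \<open>Pure tensors are the classes of the free generators, so they generate the tensor
  product. Identities between homomorphisms on a tensor product are reduced to pure tensors through
  this rule.\<close>

lemma hom_tensor_eqI:
  fixes X :: "('l::ab_group_add, 'a) tensor"
  assumes A: "comm_group A" and "comm_group G"
    and h: "h \<in> hom (tensor_group A) G" "k \<in> hom (tensor_group A) G"
    and eq: "\<And>m a. a \<in> carrier A \<Longrightarrow> h (pure_tensor A m a) = k (pure_tensor A m a)"
    and X: "X \<in> carrier (tensor_group A)"
  shows "h X = k X"
proof -
  interpret G: comm_group G by fact
  interpret T: comm_group "tensor_group A :: ('l, 'a) tensor monoid" by (rule comm_group_tensor_group) fact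
  interpret h: group_hom "tensor_group A :: ('l, 'a) tensor monoid" G h by unfold_locales (rule h)
  interpret k: group_hom "tensor_group A :: ('l, 'a) tensor monoid" G k by unfold_locales (rule h)
  interpret c: group_hom "free_Abelian_group (UNIV \<times> carrier A) :: ('l \<times> 'a \<Rightarrow>\<^sub>0 int) monoid"
    "tensor_group A" "tensor_class A"
    by (intro group_hom.intro group_hom_axioms.intro tensor_class_hom A group_free_Abelian_group
        comm_group.axioms(2) comm_group_tensor_group)
  obtain c where c: "Poly_Mapping.keys c \<subseteq> UNIV \<times> carrier A" "X = tensor_class A c"
    using X by (auto simp: carrier_tensor_group)
  have "h (tensor_class A c) = k (tensor_class A c)"
    using c(1)
  proof (rule free_Abelian_group_induct)
    show "h (tensor_class A 0) = k (tensor_class A 0)"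
      using c.hom_one h.hom_one k.hom_one by simp
  next
    fix x y
    assume 2: "Poly_Mapping.keys x \<subseteq> UNIV \<times> carrier A" "Poly_Mapping.keys y \<subseteq> UNIV \<times> carrier A"
      "h (tensor_class A x) = k (tensor_class A x)" "h (tensor_class A y) = k (tensor_class A y)"
    \<comment> \<open>Induction on the free abelian group proceeds by differences, so inverses have
      to be carried through the class map.\<close>
    have "tensor_class A (x - y) = tensor_class A x \<otimes>\<^bsub>tensor_group A\<^esub> inv\<^bsub>tensor_group A\<^esub> tensor_class A y"
      using c.hom_mult [of x "-y"] c.hom_inv [of y] 2 by simp
    moreover have "tensor_class A x \<in> carrier (tensor_group A)" "tensor_class A y \<in> carrier (tensor_group A)"
      using 2 by (simp_all add: carrier_tensor_group)
    ultimately show "h (tensor_class A (x - y)) = k (tensor_class A (x - y))"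
      using 2 by simp
  next
    fix z :: "'l \<times> 'a" assume "z \<in> UNIV \<times> carrier A"
    then show "h (tensor_class A (frag_of z)) = k (tensor_class A (frag_of z))"
      using eq by (cases z) (auto simp: pure_tensor_eq_class)
  qed
  with c show ?thesis by simp
qed

text \<open>The condition under which \<open>tensor_lift\<close> does not depend on the
  representative that it picks.\<close>

definition biadditive :: "('a, 'r) monoid_scheme \<Rightarrow> ('g, 's) monoid_scheme \<Rightarrow> ('l::ab_group_add \<Rightarrow> 'a \<Rightarrow> 'g) \<Rightarrow> bool" where
  "biadditive A G f \<longleftrightarrow>
     (\<forall>m. f m \<in> hom A G) \<and> (\<forall>m n. \<forall>a\<in>carrier A. f (m + n) a = f m a \<otimes>\<^bsub>G\<^esub> f n a)"

text \<open>The universal property of the tensor product. \<open>tensor_lift\<close> evaluates a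
  formula \<open>L\<close> on an arbitrary representative. \<open>L\<close> is a homomorphism on the
  free group whose kernel contains the relators, hence the subgroup that they generate, so it is
  constant on cosets.\<close>

lemma tensor_lift:
  fixes f :: "'l::ab_group_add \<Rightarrow> 'a \<Rightarrow> 'g"
  assumes A: "comm_group A" and G: "comm_group G" and f: "biadditive A G f"
  shows tensor_lift_hom: "tensor_lift G f \<in> hom (tensor_group A) G"
    and tensor_lift_pure: "a \<in> carrier A \<Longrightarrow> tensor_lift G f (pure_tensor A m a) = f m a"
proof -
  interpret A: comm_group A by fact
  interpret G: comm_group G by fact
  interpret T: comm_group "tensor_group A :: ('l, 'a) tensor monoid" by (rule comm_group_tensor_group) fact
  let ?F = "free_Abelian_group (UNIV \<times> carrier A) :: ('l \<times> 'a \<Rightarrow>\<^sub>0 int) monoid"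
  interpret F: comm_group ?F by (rule abelian_free_Abelian_group)
  define L where "L (c :: 'l \<times> 'a \<Rightarrow>\<^sub>0 int) = finprod G (\<lambda>(m, a). f m a [^]\<^bsub>G\<^esub> Poly_Mapping.lookup c (m, a)) (Poly_Mapping.keys c)" for c
  have fc: "f m a \<in> carrier G" if "a \<in> carrier A" for m a
    using f that by (auto simp: biadditive_def dest: hom_in_carrier)
  \<comment> \<open>Indices outside the support contribute powers with exponent 0. This lets
    \<open>c\<close>, \<open>d\<close> and \<open>c + d\<close>, where terms may cancel, be compared
    over one index set.\<close>
  have L_mono: "L c = finprod G (\<lambda>(m, a). f m a [^]\<^bsub>G\<^esub> Poly_Mapping.lookup c (m, a)) K"
    if "finite K" "Poly_Mapping.keys c \<subseteq> K" "K \<subseteq> UNIV \<times> carrier A" for c K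
    unfolding L_def using that fc
    by (intro G.finprod_mono_neutral_cong_left) (auto simp: in_keys_iff subset_iff)
  have L_hom: "L \<in> hom ?F G"
  proof (rule homI)
    fix c d
    assume cd: "c \<in> carrier ?F" "d \<in> carrier ?F"
    let ?K = "Poly_Mapping.keys c \<union> Poly_Mapping.keys d"
    have K: "finite ?K" "?K \<subseteq> UNIV \<times> carrier A" "Poly_Mapping.keys (c + d) \<subseteq> ?K"
      using cd keys_add [of c d] by auto
    have "L (c + d) = finprod G (\<lambda>x. (\<lambda>(m, a). f m a [^]\<^bsub>G\<^esub> Poly_Mapping.lookup c (m, a)) x \<otimes>\<^bsub>G\<^esub>
        (\<lambda>(m, a). f m a [^]\<^bsub>G\<^esub> Poly_Mapping.lookup d (m, a)) x) ?K"
      unfolding L_mono [OF K(1,3,2)] using K fc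
      by (intro G.finprod_cong') (auto simp: lookup_add G.int_pow_mult subset_iff)
    also have "\<dots> = L c \<otimes>\<^bsub>G\<^esub> L d"
      using K fc by (subst G.finprod_multf) (auto simp: subset_iff L_mono [of ?K])
    finally show "L (c \<otimes>\<^bsub>?F\<^esub> d) = L c \<otimes>\<^bsub>G\<^esub> L d"
      by simp
  next
    fix c assume "c \<in> carrier ?F"
    then show "L c \<in> carrier G"
      unfolding L_def using fc by (intro G.finprod_closed) (auto simp: subset_iff)
  qed
  interpret L: group_hom ?F G L by unfold_locales (rule L_hom)
  have L_frag: "L (frag_of (m, a)) = f m a" if "a \<in> carrier A" for m a
    unfolding L_def using fc [OF that] by (simp add: G.finprod_insert)
  have L_diff: "L (c - d) = L c \<otimes>\<^bsub>G\<^esub> inv\<^bsub>G\<^esub> L d" if "c \<in> carrier ?F" "d \<in> carrier ?F" for c d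
    using L.hom_mult [of c "- d"] L.hom_inv [of d] that by simp
  have cancel: "u \<otimes>\<^bsub>G\<^esub> v \<otimes>\<^bsub>G\<^esub> inv\<^bsub>G\<^esub> u \<otimes>\<^bsub>G\<^esub> inv\<^bsub>G\<^esub> v = \<one>\<^bsub>G\<^esub>"
    if "u \<in> carrier G" "v \<in> carrier G" for u v
    using that G.r_inv [of "u \<otimes>\<^bsub>G\<^esub> v"] by (simp add: G.inv_mult G.m_assoc)
  have sub: "tensor_relators A \<subseteq> kernel ?F G L"
  proof
    fix c :: "'l \<times> 'a \<Rightarrow>\<^sub>0 int"
    assume "c \<in> tensor_relators A"
    then consider m n :: 'l and a where "c = frag_of (m + n, a) - frag_of (m, a) - frag_of (n, a)" "a \<in> carrier A"
      | m :: 'l and a b where "c = frag_of (m, a \<otimes>\<^bsub>A\<^esub> b) - frag_of (m, a) - frag_of (m, b)" "a \<in> carrier A" "b \<in> carrier A"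
      unfolding tensor_relators_def by blast
    then show "c \<in> kernel ?F G L"
    proof cases
      case (1 m n a)
      have k: "frag_of (m + n, a) - frag_of (m, a) \<in> carrier ?F"
        using 1 by (fastforce dest!: subsetD [OF keys_diff])
      have k': "c \<in> carrier ?F"
        using 1 by (fastforce dest!: subsetD [OF keys_diff])
      have "L c = f (m + n) a \<otimes>\<^bsub>G\<^esub> inv\<^bsub>G\<^esub> f m a \<otimes>\<^bsub>G\<^esub> inv\<^bsub>G\<^esub> f n a"
        using 1 k by (simp add: L_diff L_frag)
      also have "f (m + n) a = f m a \<otimes>\<^bsub>G\<^esub> f n a"
        using f 1 by (simp add: biadditive_def)
      finally have "L c = \<one>\<^bsub>G\<^esub>"
        using 1 fc by (simp add: cancel)
      then show ?thesis using k' by (simp add: kernel_def)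
    next
      case (2 m a b)
      have k: "frag_of (m, a \<otimes>\<^bsub>A\<^esub> b) - frag_of (m, a) \<in> carrier ?F"
        using 2 by (fastforce dest!: subsetD [OF keys_diff])
      have k': "c \<in> carrier ?F"
        using 2 by (fastforce dest!: subsetD [OF keys_diff])
      have "L c = f m (a \<otimes>\<^bsub>A\<^esub> b) \<otimes>\<^bsub>G\<^esub> inv\<^bsub>G\<^esub> f m a \<otimes>\<^bsub>G\<^esub> inv\<^bsub>G\<^esub> f m b"
        using 2 k by (simp add: L_diff L_frag)
      also have "f m (a \<otimes>\<^bsub>A\<^esub> b) = f m a \<otimes>\<^bsub>G\<^esub> f m b"
        using f 2 by (auto simp: biadditive_def hom_mult)
      finally have "L c = \<one>\<^bsub>G\<^esub>"
        using 2 fc by (simp add: cancel)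
      then show ?thesis using k' by (simp add: kernel_def)
    qed
  qed
  have rel: "L r = \<one>\<^bsub>G\<^esub>" if "r \<in> tensor_relations A" for r
    using F.generate_subgroup_incl [OF sub L.subgroup_kernel] that
    by (auto simp: tensor_relations_def kernel_def)
  have rel_sub: "tensor_relations A \<subseteq> carrier ?F"
    using subgroup.subset [OF tensor_relations_subgroup [OF A]] .
  have lift_class: "tensor_lift G f (tensor_class A c) = L c" if c: "c \<in> carrier ?F" for c
  proof -
    have "(SOME d. d \<in> tensor_class A c) \<in> tensor_class A c"
      using group.rcos_self [OF group_free_Abelian_group c tensor_relations_subgroup [OF A]]
      unfolding tensor_class_def by (rule someI)
    \<comment> \<open>The chosen representative differs from \<open>c\<close> by a relation, which
      \<open>L\<close> kills.\<close>
    then obtain r where r: "r \<in> tensor_relations A" "(SOME d. d \<in> tensor_class A c) = r + c"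
      by (auto simp: tensor_class_def r_coset_def)
    have "L (r + c) = L r \<otimes>\<^bsub>G\<^esub> L c"
      using L.hom_mult [of r c] r rel_sub c by auto
    then show ?thesis
      using rel [OF r(1)] L.hom_closed [OF c] unfolding tensor_lift_def Let_def L_def [symmetric] r(2) by simp
  qed
  show "tensor_lift G f \<in> hom (tensor_group A) G"
  proof (rule homI)
    fix X :: "('l, 'a) tensor" assume "X \<in> carrier (tensor_group A)"
    then show "tensor_lift G f X \<in> carrier G"
      unfolding carrier_tensor_group using L.hom_closed lift_class by auto
  next
    fix X Y :: "('l, 'a) tensor" assume "X \<in> carrier (tensor_group A)" "Y \<in> carrier (tensor_group A)"
    then obtain c d where cd: "c \<in> carrier ?F" "d \<in> carrier ?F" "X = tensor_class A c" "Y = tensor_class A d"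
      unfolding carrier_tensor_group by auto
    have "X \<otimes>\<^bsub>tensor_group A\<^esub> Y = tensor_class A (c \<otimes>\<^bsub>?F\<^esub> d)"
      using cd hom_mult [OF tensor_class_hom [OF A]] by metis
    then show "tensor_lift G f (X \<otimes>\<^bsub>tensor_group A\<^esub> Y) = tensor_lift G f X \<otimes>\<^bsub>G\<^esub> tensor_lift G f Y"
      using cd lift_class F.m_closed [OF cd(1,2)] L.hom_mult [OF cd(1,2)] by metis
  qed
  show "tensor_lift G f (pure_tensor A m a) = f m a" if "a \<in> carrier A"
    using that by (simp add: pure_tensor_eq_class lift_class L_frag)
qed

lemma dual_lattice_iff: "l \<in> dual_lattice \<longleftrightarrow> (\<forall>m n. l (m + n) = l m + l n)"
  by (simp add: dual_lattice_def Modules.additive_def)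

lemma biadditive_eval:
  assumes "comm_group A" "l \<in> dual_lattice"
  shows "biadditive A A (\<lambda>m a. a [^]\<^bsub>A\<^esub> l m)"
proof -
  interpret A: comm_group A by fact
  show ?thesis
    using assms(2) unfolding biadditive_def dual_lattice_iff
    by (auto simp: A.int_pow_mult A.int_pow_distrib intro!: homI)
qed

lemma biadditive_map:
  assumes "comm_group A" "comm_group B" "f \<in> hom A B"
  shows "biadditive A (tensor_group B) (\<lambda>m a. pure_tensor B m (f a))"
  using assms hom_in_carrier [OF assms(3)] unfolding biadditive_def
  by (auto simp: hom_mult pure_tensor_add_left pure_tensor_add_right intro!: homI pure_tensor_closed)

lemma tensor_eval_hom:
  assumes "comm_group A" "l \<in> dual_lattice"
  shows "tensor_eval A l \<in> hom (tensor_group A) A"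
  unfolding tensor_eval_def using tensor_lift_hom [OF assms(1,1) biadditive_eval [OF assms]] .

lemma tensor_eval_pure:
  assumes "comm_group A" "l \<in> dual_lattice" "a \<in> carrier A"
  shows "tensor_eval A l (pure_tensor A m a) = a [^]\<^bsub>A\<^esub> l m"
  unfolding tensor_eval_def using tensor_lift_pure [OF assms(1,1) biadditive_eval [OF assms(1,2)]] assms(3) .

lemma tensor_eval_closed:
  assumes "comm_group A" "l \<in> dual_lattice" "X \<in> carrier (tensor_group A)"
  shows "tensor_eval A l X \<in> carrier A"
  using hom_in_carrier [OF tensor_eval_hom] assms by blast

lemma tensor_eval_mult:
  assumes "comm_group A" "l \<in> dual_lattice" "X \<in> carrier (tensor_group A)" "Y \<in> carrier (tensor_group A)"
  shows "tensor_eval A l (X \<otimes>\<^bsub>tensor_group A\<^esub> Y) = tensor_eval A l X \<otimes>\<^bsub>A\<^esub> tensor_eval A l Y"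
  using hom_mult [OF tensor_eval_hom] assms by blast

lemma tensor_map_hom:
  assumes "comm_group A" "comm_group B" "f \<in> hom A B"
  shows "tensor_map B f \<in> hom (tensor_group A) (tensor_group B)"
  unfolding tensor_map_def
  using tensor_lift_hom [OF assms(1) comm_group_tensor_group [OF assms(2)] biadditive_map [OF assms]] .

lemma tensor_map_pure:
  assumes "comm_group A" "comm_group B" "f \<in> hom A B" "a \<in> carrier A"
  shows "tensor_map B f (pure_tensor A m a) = pure_tensor B m (f a)"
  unfolding tensor_map_def
  using tensor_lift_pure [OF assms(1) comm_group_tensor_group [OF assms(2)] biadditive_map [OF assms(1-3)] assms(4)] .

lemma tensor_map_closed:
  assumes "comm_group A" "comm_group B" "f \<in> hom A B" "X \<in> carrier (tensor_group A)"
  shows "tensor_map B f X \<in> carrier (tensor_group B)"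
  using hom_in_carrier [OF tensor_map_hom] assms by blast

text \<open>Naturality of evaluation in the coefficient group. The exponentials,
  \<open>cscale\<close>, \<open>T_incl\<close> and both components of the inverse of
  \<open>polar\<close> arise from coefficient homomorphisms, and this rule computes their
  coordinates.\<close>

lemma tensor_eval_map:
  assumes A: "comm_group A" and B: "comm_group B" and f: "f \<in> hom A B" and l: "l \<in> dual_lattice"
    and X: "X \<in> carrier (tensor_group A)"
  shows "tensor_eval B l (tensor_map B f X) = f (tensor_eval A l X)"
proof (rule hom_tensor_eqI [OF A B _ _ _ X])
  show "(\<lambda>X. tensor_eval B l (tensor_map B f X)) \<in> hom (tensor_group A) B"
    using hom_compose [OF tensor_map_hom [OF A B f] tensor_eval_hom [OF B l]] by (simp add: comp_def)
  show "(\<lambda>X. f (tensor_eval A l X)) \<in> hom (tensor_group A) B"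
    using hom_compose [OF tensor_eval_hom [OF A l] f] by (simp add: comp_def)
  fix m a assume a: "a \<in> carrier A"
  then show "tensor_eval B l (tensor_map B f (pure_tensor A m a)) = f (tensor_eval A l (pure_tensor A m a))"
    using hom_in_carrier [OF f a] hom_int_pow [OF f a] A B
    by (simp add: tensor_map_pure [OF A B f] tensor_eval_pure A B l comm_group.axioms(2))
qed

lemma dual_lattice_add:
  "l \<in> dual_lattice \<Longrightarrow> k \<in> dual_lattice \<Longrightarrow> (\<lambda>n. l n + k n) \<in> dual_lattice"
  by (simp add: dual_lattice_iff)

lemma tensor_eval_add:
  assumes A: "comm_group A" and l: "l \<in> dual_lattice" "k \<in> dual_lattice"
    and X: "X \<in> carrier (tensor_group A)"
  shows "tensor_eval A (\<lambda>n. l n + k n) X = tensor_eval A l X \<otimes>\<^bsub>A\<^esub> tensor_eval A k X"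
proof (rule hom_tensor_eqI [OF A A _ _ _ X])
  interpret A: comm_group A by fact
  show "(\<lambda>X. tensor_eval A l X \<otimes>\<^bsub>A\<^esub> tensor_eval A k X) \<in> hom (tensor_group A) A"
    by (intro hom_mult_fun tensor_eval_hom A l)
  show "tensor_eval A (\<lambda>n. l n + k n) (pure_tensor A m a) =
      tensor_eval A l (pure_tensor A m a) \<otimes>\<^bsub>A\<^esub> tensor_eval A k (pure_tensor A m a)" if "a \<in> carrier A" for m a
    using that by (simp add: tensor_eval_pure A l dual_lattice_add A.int_pow_mult)
qed (intro tensor_eval_hom A dual_lattice_add l)

text \<open>The zero functional is its own double, so its value is an idempotent, and the only
  idempotent of a group is the unit.\<close>

lemma tensor_eval_0:
  assumes A: "comm_group A" and X: "X \<in> carrier (tensor_group A)"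
  shows "tensor_eval A (\<lambda>n. 0) X = \<one>\<^bsub>A\<^esub>"
proof -
  interpret A: comm_group A by fact
  have 0: "(\<lambda>n. 0) \<in> dual_lattice" by (simp add: dual_lattice_iff)
  have "tensor_eval A (\<lambda>n. 0) X \<otimes>\<^bsub>A\<^esub> tensor_eval A (\<lambda>n. 0) X = tensor_eval A (\<lambda>n. 0) X"
    using tensor_eval_add [OF A 0 0 X] by simp
  then show ?thesis
    using tensor_eval_closed [OF A 0 X] by simp
qed

section \<open>Lattice bases and coordinates on tensor products\<close>

lemma finprod_additive_group: "finite S \<Longrightarrow> finprod additive_group f S = sum f S"
proof (induction S rule: finite_induct)
  case empty
  interpret A: comm_group "additive_group :: 'b monoid" by simp
  show ?case by simp
next
  case (insert x F)
  interpret A: comm_group "additive_group :: 'b monoid" by simp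
  show ?case using insert by simp
qed

text \<open>A finite basis with its dual basis. As \<open>'l\<close> is only an additive group,
  integer multiples are written as powers in \<open>additive_group\<close>. An empty
  \<open>S\<close> is the lattice of rank zero.\<close>

locale lattice_basis =
  fixes S :: "nat set" and e :: "nat \<Rightarrow> 'l::ab_group_add" and c :: "nat \<Rightarrow> 'l \<Rightarrow> int"
  assumes finite_S: "finite S"
    and c_dual: "i \<in> S \<Longrightarrow> c i \<in> dual_lattice"
    and c_e: "i \<in> S \<Longrightarrow> j \<in> S \<Longrightarrow> c i (e j) = (if i = j then 1 else 0)"
    and expand: "(\<Sum>i\<in>S. e i [^]\<^bsub>additive_group\<^esub> c i m) = m"

text \<open>The standard basis of the free abelian group is pulled back along the isomorphism
  \<open>g\<close>, and the dual basis reads off coefficients. The expansion is verified after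
  applying the injective \<open>g\<close>.\<close>

lemma is_lattice_imp_basis:
  assumes "is_lattice (additive_group :: 'l::ab_group_add monoid)"
  shows "\<exists>S (e :: nat \<Rightarrow> 'l) c. lattice_basis S e c"
proof -
  obtain S :: "nat set" and g where S: "finite S" and g: "g \<in> iso (additive_group :: 'l monoid) (free_Abelian_group S)"
    using assms unfolding is_lattice_def is_iso_def by blast
  let ?F = "free_Abelian_group S"
  have bij: "bij_betw g UNIV (carrier ?F)" and hom: "g \<in> hom (additive_group :: 'l monoid) ?F"
    using g by (auto simp: iso_def)
  have inj: "inj g" using bij by (simp add: bij_betw_def)
  define e where "e i = inv_into UNIV g (frag_of i)" for i
  define c where "c i m = Poly_Mapping.lookup (g m) i" for i m
  have g_add: "g (m + n) = g m + g n" for m n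
    using hom_mult [OF hom, of m n] by simp
  have g_keys: "Poly_Mapping.keys (g m) \<subseteq> S" for m
    using hom_in_carrier [OF hom, of m] by simp
  have g_e: "g (e i) = frag_of i" if "i \<in> S" for i
    unfolding e_def using that bij_betw_imp_surj_on [OF bij] by (intro f_inv_into_f) simp
  have "g (\<Sum>i\<in>S. e i [^]\<^bsub>additive_group\<^esub> c i m) = g m" for m
  proof -
    have g_sum: "g (sum f S) = (\<Sum>i\<in>S. g (f i))" for f
      using S
    proof (induction S rule: finite_induct)
      case empty
      show ?case using g_add [of 0 0] by simp
    qed (simp add: g_add)
    have "g (e i [^]\<^bsub>additive_group\<^esub> c i m) = frag_cmul (c i m) (frag_of i)" if "i \<in> S" for i
      using hom_int_pow [OF hom, of "e i" "c i m"] that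
      by (simp add: g_e comm_group.axioms(2))
    then have "g (\<Sum>i\<in>S. e i [^]\<^bsub>additive_group\<^esub> c i m) = (\<Sum>i\<in>S. frag_cmul (c i m) (frag_of i))"
      by (simp add: g_sum)
    \<comment> \<open>Coefficients vanish off the support, which cuts the sum down to the form
      treated by \<open>frag_expansion\<close>.\<close>
    also have "\<dots> = (\<Sum>i\<in>Poly_Mapping.keys (g m). frag_cmul (c i m) (frag_of i))"
      using S g_keys by (intro sum.mono_neutral_right) (auto simp: c_def in_keys_iff)
    also have "\<dots> = g m"
      using frag_expansion [of "g m"] by (simp add: frag_extend_def c_def)
    finally show ?thesis .
  qed
  then have "lattice_basis S e c"
    using S by unfold_locales (auto simp: c_def g_add g_e dual_lattice_iff lookup_add dest: injD [OF inj])
  then show ?thesis by blast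
qed

context lattice_basis
begin

lemma hom_expand:
  assumes h: "h \<in> hom additive_group G" and G: "comm_group G"
  shows "h m = finprod G (\<lambda>i. h (e i) [^]\<^bsub>G\<^esub> c i m) S"
proof -
  interpret G: comm_group G by fact
  have "h m = h (finprod additive_group (\<lambda>i. e i [^]\<^bsub>additive_group\<^esub> c i m) S)"
    by (simp add: finprod_additive_group finite_S expand)
  also have "\<dots> = finprod G (\<lambda>i. h (e i [^]\<^bsub>additive_group\<^esub> c i m)) S"
    by (rule hom_finprod [OF h]) (auto simp: G)
  also have "\<dots> = finprod G (\<lambda>i. h (e i) [^]\<^bsub>G\<^esub> c i m) S"
    using hom_in_carrier [OF h] hom_int_pow [OF h] G
    by (intro G.finprod_cong') (auto simp: comm_group.axioms(2))
  finally show ?thesis .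
qed

text \<open>Both sides are homomorphisms in \<open>X\<close>, so only a pure tensor of
  \<open>m\<close> and \<open>a\<close> matters. There \<open>m\<close> is expanded in the basis,
  and the integers \<open>c i m\<close> are moved across the tensor sign onto
  \<open>a\<close>.\<close>

lemma tensor_expand:
  fixes X :: "('l, 'a) tensor"
  assumes A: "comm_group A" and X: "X \<in> carrier (tensor_group A)"
  shows "X = finprod (tensor_group A) (\<lambda>i. pure_tensor A (e i) (tensor_eval A (c i) X)) S"
proof -
  have T: "comm_group (tensor_group A :: ('l, 'a) tensor monoid)" by (rule comm_group_tensor_group [OF A])
  interpret T: comm_group "tensor_group A :: ('l, 'a) tensor monoid" by (rule T)
  have pr: "pure_tensor A m \<in> hom A (tensor_group A)" for m :: 'l
    by (intro homI pure_tensor_closed pure_tensor_add_right A)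
  show ?thesis
  proof (rule hom_tensor_eqI [OF A T, of "\<lambda>X. X", OF _ _ _ X])
    show "(\<lambda>X. X) \<in> hom (tensor_group A :: ('l, 'a) tensor monoid) (tensor_group A)"
      by (auto simp: hom_def)
    show "(\<lambda>X. finprod (tensor_group A) (\<lambda>i. pure_tensor A (e i) (tensor_eval A (c i) X)) S) \<in> hom (tensor_group A) (tensor_group A)"
    proof (rule hom_finprod_fun [OF T finite_S])
      fix i assume "i \<in> S"
      then show "(\<lambda>X. pure_tensor A (e i) (tensor_eval A (c i) X)) \<in> hom (tensor_group A) (tensor_group A)"
        using hom_compose [OF tensor_eval_hom [OF A c_dual] pr] by (simp add: comp_def)
    qed
  next
    fix m :: 'l and a assume a: "a \<in> carrier A"
    have "(\<lambda>m. pure_tensor A m a) \<in> hom additive_group (tensor_group A)"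
      using a by (intro homI) (auto intro: pure_tensor_closed simp: pure_tensor_add_left A)
    from hom_expand [OF this T, of m]
    have "pure_tensor A m a = finprod (tensor_group A) (\<lambda>i. pure_tensor A (e i) a [^]\<^bsub>tensor_group A\<^esub> c i m) S" .
    also have "\<dots> = finprod (tensor_group A) (\<lambda>i. pure_tensor A (e i) (tensor_eval A (c i) (pure_tensor A m a))) S"
    proof (rule T.finprod_cong')
      fix i assume "i \<in> S"
      then show "pure_tensor A (e i) a [^]\<^bsub>tensor_group A\<^esub> c i m = pure_tensor A (e i) (tensor_eval A (c i) (pure_tensor A m a))"
        using hom_int_pow [OF pr a] a A T.is_group
        by (simp add: tensor_eval_pure c_dual comm_group.axioms(2))
    qed (use a A in \<open>auto intro!: pure_tensor_closed tensor_eval_closed c_dual\<close>)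
    finally show "pure_tensor A m a = finprod (tensor_group A) (\<lambda>i. pure_tensor A (e i) (tensor_eval A (c i) (pure_tensor A m a))) S" .
  qed
qed

text \<open>By \<open>tensor_expand\<close> an element is rebuilt from its coordinates. This is the
  equality test for the vector space and the two tori, where it becomes \<open>t_eqI\<close>,
  \<open>T_eqI\<close> and \<open>TC_eqI\<close>.\<close>

lemma tensor_eqI_basis:
  assumes A: "comm_group A" and X: "X \<in> carrier (tensor_group A)" "Y \<in> carrier (tensor_group A)"
    and eq: "\<And>i. i \<in> S \<Longrightarrow> tensor_eval A (c i) X = tensor_eval A (c i) (Y :: ('l, 'a) tensor)"
  shows "X = Y"
proof -
  interpret T: comm_group "tensor_group A :: ('l, 'a) tensor monoid" by (rule comm_group_tensor_group [OF A])
  have "finprod (tensor_group A) (\<lambda>i. pure_tensor A (e i) (tensor_eval A (c i) X)) S =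
      finprod (tensor_group A) (\<lambda>i. pure_tensor A (e i) (tensor_eval A (c i) Y)) S"
    using X by (intro T.finprod_cong') (auto intro!: pure_tensor_closed tensor_eval_closed c_dual A eq arg_cong [of _ _ "pure_tensor A _"])
  then show ?thesis
    using tensor_expand [OF A X(1)] tensor_expand [OF A X(2)] by simp
qed

text \<open>The inverse of the coordinate isomorphism onto the power of \<open>A\<close> indexed by
  \<open>S\<close>.\<close>

definition from_coords :: "('a, 'r) monoid_scheme \<Rightarrow> (nat \<Rightarrow> 'a) \<Rightarrow> ('l, 'a) tensor" where
  "from_coords A a = finprod (tensor_group A) (\<lambda>i. pure_tensor A (e i) (a i)) S"

lemma from_coords_closed:
  assumes A: "comm_group A" and a: "a \<in> S \<rightarrow> carrier A"
  shows "from_coords A a \<in> carrier (tensor_group A)"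
proof -
  interpret T: comm_group "tensor_group A :: ('l, 'a) tensor monoid" by (rule comm_group_tensor_group [OF A])
  show ?thesis unfolding from_coords_def using a by (intro T.finprod_closed) (auto intro: pure_tensor_closed)
qed

lemma tensor_eval_from_coords:
  assumes A: "comm_group A" and a: "a \<in> S \<rightarrow> carrier A" and l: "l \<in> dual_lattice"
  shows "tensor_eval A l (from_coords A a) = finprod A (\<lambda>i. a i [^]\<^bsub>A\<^esub> l (e i)) S"
proof -
  interpret A: comm_group A by (rule A)
  have "tensor_eval A l (from_coords A a) = finprod A (\<lambda>i. tensor_eval A l (pure_tensor A (e i) (a i))) S"
    unfolding from_coords_def using a
    by (intro hom_finprod tensor_eval_hom comm_group_tensor_group A l) (auto intro: pure_tensor_closed)
  also have "\<dots> = finprod A (\<lambda>i. a i [^]\<^bsub>A\<^esub> l (e i)) S"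
    using a by (intro A.finprod_cong') (auto simp: tensor_eval_pure A l Pi_iff)
  finally show ?thesis .
qed

lemma tensor_eval_from_coords_basis:
  assumes A: "comm_group A" and a: "a \<in> S \<rightarrow> carrier A" and j: "j \<in> S"
  shows "tensor_eval A (c j) (from_coords A a) = a j"
proof -
  interpret A: comm_group A by (rule A)
  have "tensor_eval A (c j) (from_coords A a) = finprod A (\<lambda>i. if j = i then a i else \<one>\<^bsub>A\<^esub>) S"
    using a j by (subst tensor_eval_from_coords [OF A a c_dual]) (auto intro!: A.finprod_cong' simp: c_e Pi_iff)
  also have "\<dots> = a j"
    using A.finprod_singleton [OF j finite_S a] .
  finally show ?thesis .
qed

text \<open>The witness is the combination of the \<open>e i\<close> with coefficients
  \<open>n i\<close>. It assembles integral coordinate differences into a single lattice vector when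
  the kernel of \<open>exp_T\<close> is determined.\<close>

lemma lattice_element_exists: "\<exists>m. \<forall>i\<in>S. c i m = n i"
proof -
  have "c j (\<Sum>i\<in>S. e i [^]\<^bsub>additive_group\<^esub> n i) = n j" if j: "j \<in> S" for j
  proof -
    have hom: "c j \<in> hom additive_group additive_group"
      using c_dual [OF j] by (auto simp: dual_lattice_iff hom_def)
    have "c j (\<Sum>i\<in>S. e i [^]\<^bsub>additive_group\<^esub> n i) = (\<Sum>i\<in>S. c j (e i [^]\<^bsub>additive_group\<^esub> n i))"
      using hom_finprod [OF hom _ _, of "\<lambda>i. e i [^]\<^bsub>additive_group\<^esub> n i" S]
      by (simp add: finprod_additive_group finite_S)
    also have "\<dots> = (\<Sum>i\<in>S. if j = i then n i else 0)"
      using hom_int_pow [OF hom] j by (intro sum.cong) (auto simp: comm_group.axioms(2) c_e additive_int_pow)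
    finally show ?thesis using j finite_S by simp
  qed
  then show ?thesis by blast
qed

lemma lattice_element_unique:
  assumes "\<And>i. i \<in> S \<Longrightarrow> c i m = c i n"
  shows "m = n"
proof -
  have "(\<Sum>i\<in>S. e i [^]\<^bsub>additive_group\<^esub> c i m) = (\<Sum>i\<in>S. e i [^]\<^bsub>additive_group\<^esub> c i n)"
    using assms by (intro sum.cong) auto
  then show ?thesis
    unfolding expand .
qed

end

subsection \<open>Quotient line bundles\<close>

text \<open>Meant for outer functions that are continuous only on a subset, such as
  \<open>inverse\<close>, \<open>Arg\<close> and \<open>q_log\<close>.\<close>

lemma continuous_map_comp_on:
  assumes "continuous_map Z euclidean f" "\<And>z. z \<in> topspace Z \<Longrightarrow> f z \<in> A" "continuous_on A h"
  shows "continuous_map Z euclidean (\<lambda>z. h (f z))"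
proof -
  have "continuous_map Z (top_of_set A) f"
    using assms(1,2) by (auto simp: continuous_map_in_subtopology)
  moreover have "continuous_map (top_of_set A) euclidean h"
    using assms(3) by simp
  ultimately have "continuous_map Z euclidean (h \<circ> f)"
    by (rule continuous_map_compose)
  then show ?thesis by (simp add: comp_def)
qed

lemma continuous_map_mult:
  fixes f h :: "'a \<Rightarrow> 'b::real_normed_algebra"
  assumes "continuous_map Z euclidean f" "continuous_map Z euclidean h"
  shows "continuous_map Z euclidean (\<lambda>z. f z * h z)"
proof -
  have "continuous_map Z euclidean (\<lambda>z. (f z, h z))"
    using continuous_map_pairedI [OF assms] by (simp add: euclidean_product_topology)
  from continuous_map_comp_on [OF this, of UNIV "\<lambda>x. fst x * snd x"] show ?thesis
    by (simp add: continuous_intros)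
qed

text \<open>If \<sigma> is a section near \<open>f x\<close> passing through \<open>x\<close>, then
  the preimage of an open set under \<sigma> is an open neighbourhood of \<open>f x\<close>, and it
  lies in the image of that set because \<open>f\<close> undoes \<sigma>.\<close>

lemma open_map_if_local_sections:
  assumes "\<And>x. x \<in> topspace X \<Longrightarrow> \<exists>U \<sigma>. openin Y U \<and> f x \<in> U \<and>
      continuous_map (subtopology Y U) X \<sigma> \<and> (\<forall>y\<in>U. f (\<sigma> y) = y) \<and> \<sigma> (f x) = x"
  shows "open_map X Y f"
  unfolding open_map_def
proof (intro allI impI)
  fix O' assume O': "openin X O'"
  show "openin Y (f ` O')"
  proof (subst openin_subopen, intro ballI)
    fix y assume "y \<in> f ` O'"
    then obtain x where x: "x \<in> O'" "y = f x" by blast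
    then obtain U \<sigma> where U: "openin Y U" "f x \<in> U" "continuous_map (subtopology Y U) X \<sigma>"
        "\<forall>y\<in>U. f (\<sigma> y) = y" "\<sigma> (f x) = x"
      using assms openin_subset [OF O'] by blast
    have "openin (subtopology Y U) {u \<in> topspace (subtopology Y U). \<sigma> u \<in> O'}"
      using U(3) O' by (rule openin_continuous_map_preimage)
    then have "openin Y {u \<in> topspace (subtopology Y U). \<sigma> u \<in> O'}"
      using U(1) openin_trans_full by blast
    moreover have "y \<in> {u \<in> topspace (subtopology Y U). \<sigma> u \<in> O'}"
      using U x openin_subset [OF U(1)] by auto
    moreover have "{u \<in> topspace (subtopology Y U). \<sigma> u \<in> O'} \<subseteq> f ` O'"
      using U(4) by force
    ultimately show "\<exists>T. openin Y T \<and> y \<in> T \<and> T \<subseteq> f ` O'"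
      by blast
  qed
qed

lemma open_map_map_prod:
  assumes "open_map X X' f" "open_map Y Y' g"
  shows "open_map (prod_topology X Y) (prod_topology X' Y') (\<lambda>(x, y). (f x, g y))"
  unfolding open_map_def
proof (intro allI impI)
  fix O' assume O': "openin (prod_topology X Y) O'"
  show "openin (prod_topology X' Y') ((\<lambda>(x, y). (f x, g y)) ` O')"
    unfolding openin_prod_topology_alt
  proof (intro allI impI)
    fix a b assume "(a, b) \<in> (\<lambda>(x, y). (f x, g y)) ` O'"
    then obtain x y where xy: "(x, y) \<in> O'" "a = f x" "b = g y" by auto
    then obtain U V where UV: "openin X U" "openin Y V" "x \<in> U" "y \<in> V" "U \<times> V \<subseteq> O'"
      using O' [unfolded openin_prod_topology_alt, rule_format, OF xy(1)] by blast
    have "f ` U \<times> g ` V \<subseteq> (\<lambda>(x, y). (f x, g y)) ` O'"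
      using UV(5) by force
    then show "\<exists>U V. openin X' U \<and> openin Y' V \<and> a \<in> U \<and> b \<in> V \<and> U \<times> V \<subseteq> (\<lambda>(x, y). (f x, g y)) ` O'"
      using assms UV(1-4) xy(2,3) unfolding open_map_def
      by (intro exI [of _ "f ` U"] exI [of _ "g ` V"]) auto
  qed
qed

text \<open>\<open>k\<close> after \<open>f\<close> agrees with the quotient map \<open>f'\<close>
  after \<open>h\<close>, so \<open>k\<close> is itself a quotient map, and equality of fibres makes
  it injective. The rule serves both the base map and the map of total spaces.\<close>

lemma homeomorphic_map_between_quotients:
  assumes f: "quotient_map X Y f" and f': "quotient_map X' Y' f'" and h: "homeomorphic_map X X' h"
    and fibres: "\<And>x y. x \<in> topspace X \<Longrightarrow> y \<in> topspace X \<Longrightarrow> f x = f y \<longleftrightarrow> f' (h x) = f' (h y)"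
    and k: "\<And>x. x \<in> topspace X \<Longrightarrow> k (f x) = f' (h x)"
  shows "homeomorphic_map Y Y' k"
proof -
  have q: "quotient_map X Y' (f' \<circ> h)"
    using h f' by (auto simp: homeomorphic_map_def intro: quotient_map_compose)
  then have q': "quotient_map X Y' (k \<circ> f)"
    by (rule quotient_map_eq) (simp add: k)
  have c: "continuous_map Y Y' k"
    using continuous_compose_quotient_map [OF f quotient_imp_continuous_map [OF q']] .
  have "quotient_map Y Y' k"
    using quotient_map_from_composition [OF quotient_imp_continuous_map [OF f] c q'] .
  moreover have "inj_on k (topspace Y)"
    unfolding quotient_imp_surjective_map [OF f, symmetric] by (auto simp: inj_on_def k fibres)
  ultimately show ?thesis
    by (simp add: homeomorphic_map_def)
qed

section \<open>Quotient topologies and transport of line bundle structures\<close>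

lemma openin_quotient_topology:
  "openin (quotient_topology X R) V \<longleftrightarrow> V \<subseteq> topspace X // R \<and> openin X {x \<in> topspace X. R `` {x} \<in> V}"
  unfolding quotient_topology_def topology_inverse' [OF istopology_quotient] ..

lemma topspace_quotient_topology [simp]: "topspace (quotient_topology X R) = topspace X // R"
proof (rule antisym)
  show "topspace (quotient_topology X R) \<subseteq> topspace X // R"
    using openin_topspace [of "quotient_topology X R"] unfolding openin_quotient_topology by blast
  have "{x \<in> topspace X. R `` {x} \<in> topspace X // R} = topspace X"
    by (auto intro: quotientI)
  then show "topspace X // R \<subseteq> topspace (quotient_topology X R)"
    by (intro openin_subset) (simp add: openin_quotient_topology)
qed

lemma quotient_map_class: "quotient_map X (quotient_topology X R) (\<lambda>x. R `` {x})"
  unfolding quotient_map_def by (auto simp: openin_quotient_topology) (auto simp: quotient_def)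

text \<open>A trivialization of \<open>E\<close> over \<open>U\<close> is conjugated to one of
  \<open>F\<close> over the image of \<open>U\<close>: go back along the inverse \<gamma> of
  \<beta>, trivialize, and go forward along \<phi>. It supplies local triviality of the Looijenga
  bundle.\<close>

lemma complex_line_bundle_transport:
  assumes E: "complex_line_bundle E"
    and \<beta>: "homeomorphic_map (base E) (base F) \<beta>" and \<phi>: "homeomorphic_map (total E) (total F) \<phi>"
    and proj: "\<And>e. e \<in> topspace (total E) \<Longrightarrow> proj F (\<phi> e) = \<beta> (proj E e)"
    and add: "\<And>e e'. e \<in> topspace (total E) \<Longrightarrow> e' \<in> topspace (total E) \<Longrightarrow> proj E e = proj E e' \<Longrightarrow>
        \<phi> (fibre_add E e e') = fibre_add F (\<phi> e) (\<phi> e')"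
    and scale: "\<And>e w. e \<in> topspace (total E) \<Longrightarrow> \<phi> (fibre_scale E w e) = fibre_scale F w (\<phi> e)"
  shows "complex_line_bundle F"
proof -
  have projE: "continuous_map (total E) (base E) (proj E)"
    using E by (simp add: complex_line_bundle_def)
  obtain \<gamma> where \<gamma>: "homeomorphic_maps (base E) (base F) \<beta> \<gamma>"
    using \<beta> homeomorphic_map_maps by blast
  have \<gamma>_map: "homeomorphic_map (base F) (base E) \<gamma>"
    using \<gamma> homeomorphic_maps_map by blast
  have \<beta>\<gamma>: "\<beta> (\<gamma> b) = b" "\<gamma> b \<in> topspace (base E)" if "b \<in> topspace (base F)" for b
    using \<gamma> that by (auto simp: homeomorphic_maps_def continuous_map_def)
  have \<gamma>\<beta>: "\<gamma> (\<beta> b) = b" "\<beta> b \<in> topspace (base F)" if "b \<in> topspace (base E)" for b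
    using \<gamma> that by (auto simp: homeomorphic_maps_def continuous_map_def)
  have \<phi>_surj: "\<phi> ` topspace (total E) = topspace (total F)"
    using \<phi> by (rule homeomorphic_imp_surjective_map)
  \<comment> \<open>Continuity of \<open>proj F\<close> is tested after the quotient map \<phi>,
    where it becomes continuity of this composite.\<close>
  have "continuous_map (total E) (base F) (\<beta> \<circ> proj E)"
    using continuous_map_compose [OF projE homeomorphic_imp_continuous_map [OF \<beta>]] .
  then have "continuous_map (total E) (base F) (proj F \<circ> \<phi>)"
    by (rule continuous_map_eq) (simp add: proj)
  then have projF: "continuous_map (total F) (base F) (proj F)"
    using \<phi> continuous_compose_quotient_map homeomorphic_map_def by blast
  moreover have "\<exists>U \<psi>. openin (base F) U \<and> q \<in> U \<and>
        homeomorphic_map (prod_topology (subtopology (base F) U) euclidean)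
          (subtopology (total F) {e \<in> topspace (total F). proj F e \<in> U}) \<psi> \<and>
        (\<forall>u\<in>U. \<forall>z w. proj F (\<psi> (u, z)) = u \<and>
           fibre_add F (\<psi> (u, z)) (\<psi> (u, w)) = \<psi> (u, z + w) \<and>
           fibre_scale F w (\<psi> (u, z)) = \<psi> (u, w * z))"
    if q: "q \<in> topspace (base F)" for q
  proof -
    obtain U \<psi> where U: "openin (base E) U" "\<gamma> q \<in> U"
      and \<psi>: "homeomorphic_map (prod_topology (subtopology (base E) U) euclidean)
          (subtopology (total E) {e \<in> topspace (total E). proj E e \<in> U}) \<psi>"
      and lin: "\<And>u z w. u \<in> U \<Longrightarrow> proj E (\<psi> (u, z)) = u \<and>
           fibre_add E (\<psi> (u, z)) (\<psi> (u, w)) = \<psi> (u, z + w) \<and>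
           fibre_scale E w (\<psi> (u, z)) = \<psi> (u, w * z)"
      using E \<beta>\<gamma>(2) [OF q] unfolding complex_line_bundle_def by meson
    have Usub: "U \<subseteq> topspace (base E)" using U openin_subset by blast
    let ?V = "\<beta> ` U"
    have V: "openin (base F) ?V" "q \<in> ?V"
      using U \<beta> \<beta>\<gamma> [OF q] by (auto simp: homeomorphic_map_openness_eq [OF \<beta>] image_iff) force+
    have Vsub: "?V \<subseteq> topspace (base F)" using V openin_subset by blast
    have \<gamma>V: "\<gamma> b \<in> U" "\<beta> (\<gamma> b) = b" if "b \<in> ?V" for b
      using that \<gamma>\<beta> Usub by auto
    have "homeomorphic_map (subtopology (base F) ?V) (subtopology (base E) U) \<gamma>"
    proof (rule homeomorphic_map_subtopologies [OF \<gamma>_map])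
      show "\<gamma> ` (topspace (base F) \<inter> \<beta> ` U) = topspace (base E) \<inter> U"
        using \<gamma>\<beta> Usub Vsub by force
    qed
    then have h1: "homeomorphic_map (prod_topology (subtopology (base F) ?V) euclidean)
        (prod_topology (subtopology (base E) U) euclidean) (\<lambda>(b, z :: complex). (\<gamma> b, id z))"
      using homeomorphic_maps_prod [of "subtopology (base F) ?V" "euclidean :: complex topology" "subtopology (base E) U"
          euclidean \<gamma> id _ id] homeomorphic_maps_id [of "euclidean :: complex topology"]
      unfolding homeomorphic_map_maps by blast
    have h3: "homeomorphic_map (subtopology (total E) {e \<in> topspace (total E). proj E e \<in> U})
       (subtopology (total F) {e \<in> topspace (total F). proj F e \<in> ?V}) \<phi>"
    proof (rule homeomorphic_map_subtopologies [OF \<phi>])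
      show "\<phi> ` (topspace (total E) \<inter> {e \<in> topspace (total E). proj E e \<in> U}) =
          topspace (total F) \<inter> {e \<in> topspace (total F). proj F e \<in> \<beta> ` U}"
      proof (intro equalityI subsetI)
        fix f assume "f \<in> \<phi> ` (topspace (total E) \<inter> {e \<in> topspace (total E). proj E e \<in> U})"
        then show "f \<in> topspace (total F) \<inter> {e \<in> topspace (total F). proj F e \<in> \<beta> ` U}"
          using \<phi>_surj proj by auto
      next
        fix f assume f: "f \<in> topspace (total F) \<inter> {e \<in> topspace (total F). proj F e \<in> \<beta> ` U}"
        then obtain e where e: "e \<in> topspace (total E)" "f = \<phi> e"
          using \<phi>_surj by auto
        have "proj E e \<in> topspace (base E)"
          using projE e(1) by (auto simp: continuous_map_def)
        moreover have "\<beta> (proj E e) \<in> \<beta> ` U"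
          using f e proj by auto
        ultimately have "proj E e \<in> U"
          using \<gamma>\<beta> Usub by (metis image_iff subsetD)
        then show "f \<in> \<phi> ` (topspace (total E) \<inter> {e \<in> topspace (total E). proj E e \<in> U})"
          using e by auto
      qed
    qed
    let ?\<psi> = "\<phi> \<circ> (\<psi> \<circ> (\<lambda>(b, z). (\<gamma> b, id z)))"
    have "homeomorphic_map (prod_topology (subtopology (base F) ?V) euclidean)
          (subtopology (total F) {e \<in> topspace (total F). proj F e \<in> ?V}) ?\<psi>"
      using homeomorphic_map_compose [OF homeomorphic_map_compose [OF h1 \<psi>] h3] .
    moreover have \<psi>_in: "\<psi> (u, z) \<in> topspace (total E)" if "u \<in> U" for u z
      using homeomorphic_imp_surjective_map [OF \<psi>] that Usub by fastforce
    have "proj F (?\<psi> (u, z)) = u \<and> fibre_add F (?\<psi> (u, z)) (?\<psi> (u, w)) = ?\<psi> (u, z + w) \<and>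
        fibre_scale F w (?\<psi> (u, z)) = ?\<psi> (u, w * z)" if "u \<in> ?V" for u z w
      using \<gamma>V [OF that] lin [OF \<gamma>V(1) [OF that]] \<psi>_in [OF \<gamma>V(1) [OF that]]
      by (simp add: proj add [symmetric] scale [symmetric])
    ultimately show ?thesis using V by blast
  qed
  ultimately show ?thesis
    unfolding complex_line_bundle_def by blast
qed

text \<open>Conditions making the quotient a line bundle. For points \<open>v\<close>,
  \<open>w\<close> with the same image under \<open>p\<close>, the relation is the graph of a linear
  isomorphism between the fibres: \<open>R_total\<close> makes it defined everywhere,
  \<open>R_free\<close> together with the equivalence laws makes it single valued, and
  \<open>R_scale\<close> and \<open>R_add\<close> make it linear. The last three conditions say that
  \<open>p\<close> is a surjective local homeomorphism, so local sections exist.\<close>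

locale fibrewise_linear_rel =
  fixes X :: "'x topology" and R :: "('x \<times> complex) rel" and B :: "'b topology" and p :: "'x \<Rightarrow> 'b"
  assumes equiv_R: "equiv (topspace X \<times> UNIV) R"
    and R_fibre: "((v, z), (w, c)) \<in> R \<Longrightarrow> p v = p w"
    and R_scale: "((v, z), (w, c)) \<in> R \<Longrightarrow> ((v, a * z), (w, a * c)) \<in> R"
    and R_add: "((v, z), (w, c)) \<in> R \<Longrightarrow> ((v, z'), (w, c')) \<in> R \<Longrightarrow> ((v, z + z'), (w, c + c')) \<in> R"
    and R_free: "((v, z), (v, c)) \<in> R \<Longrightarrow> z = c"
    and R_total: "v \<in> topspace X \<Longrightarrow> w \<in> topspace X \<Longrightarrow> p v = p w \<Longrightarrow> \<exists>c. ((v, z), (w, c)) \<in> R"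
    and R_open: "openin (prod_topology X euclidean) V \<Longrightarrow> openin (prod_topology X euclidean) (R `` V)"
    and p_cont: "continuous_map X B p" and p_open: "open_map X B p"
    and p_local: "b \<in> topspace B \<Longrightarrow> \<exists>W. openin X W \<and> b \<in> p ` W \<and> inj_on p W"
begin

abbreviation "Q \<equiv> prod_topology X (euclidean :: complex topology)"
abbreviation "cls v \<equiv> R `` {v}"

lemma R_topspace: "((v, z), (w, c)) \<in> R \<Longrightarrow> v \<in> topspace X \<and> w \<in> topspace X"
  using equiv_R unfolding equiv_def refl_on_def by auto

lemma cls_eq_iff:
  "v \<in> topspace X \<Longrightarrow> w \<in> topspace X \<Longrightarrow> cls (v, z) = cls (w, c) \<longleftrightarrow> ((v, z), (w, c)) \<in> R"
  using eq_equiv_class_iff [OF equiv_R] by auto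

lemma cls_self: "v \<in> topspace X \<Longrightarrow> (v, z) \<in> cls (v, z)"
  using equiv_class_self [OF equiv_R] by auto

lemma topspace_total: "topspace (total (quotient_bundle X R B p)) = (topspace X \<times> UNIV) // R"
  by (simp add: quotient_bundle_def)

lemma quotient_map_cls: "quotient_map Q (total (quotient_bundle X R B p)) cls"
  using quotient_map_class by (simp add: quotient_bundle_def)

text \<open>The preimage of the image of an open set under the class map is its saturation, so this
  is \<open>R_open\<close> seen in the quotient.\<close>

lemma open_map_cls: "open_map Q (total (quotient_bundle X R B p)) cls"
  unfolding open_map_def
proof (intro allI impI)
  fix V assume V: "openin Q V"
  have sub: "V \<subseteq> topspace X \<times> UNIV"
    using openin_subset [OF V] by simp
  have "{x \<in> topspace X \<times> UNIV. cls x \<in> cls ` V} = R `` V"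
  proof (intro equalityI subsetI)
    fix x assume "x \<in> {x \<in> topspace X \<times> UNIV. cls x \<in> cls ` V}"
    then obtain y where "y \<in> V" "cls x = cls y" "x \<in> topspace X \<times> UNIV" by auto
    then have "(y, x) \<in> R" using sub eq_equiv_class_iff [OF equiv_R, of y x] by auto
    then show "x \<in> R `` V" using \<open>y \<in> V\<close> by blast
  next
    fix x assume "x \<in> R `` V"
    then obtain y where y: "y \<in> V" "(y, x) \<in> R" by blast
    moreover from y have "x \<in> topspace X \<times> UNIV" using R_topspace by (cases x; cases y) auto
    moreover have "cls x = cls y" using equiv_class_eq [OF equiv_R y(2)] by simp
    ultimately show "x \<in> {x \<in> topspace X \<times> UNIV. cls x \<in> cls ` V}" by blast
  qed
  then show "openin (total (quotient_bundle X R B p)) (cls ` V)"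
    using sub R_open [OF V] by (auto simp: quotient_bundle_def openin_quotient_topology intro: quotientI)
qed

text \<open>\<open>proj\<close> uses an arbitrary representative, and \<open>R_fibre\<close> makes
  the choice harmless.\<close>

lemma proj_cls:
  assumes "v \<in> topspace X"
  shows "proj (quotient_bundle X R B p) (cls (v, z)) = p v"
proof -
  have "(SOME x. x \<in> cls (v, z)) \<in> cls (v, z)"
    using cls_self [OF assms] by (rule someI)
  then have "p v = p (fst (SOME x. x \<in> cls (v, z)))"
    using R_fibre by (metis Image_singleton_iff prod.collapse)
  then show ?thesis by (simp add: quotient_bundle_def)
qed

text \<open>The sum in \<open>quotient_bundle\<close> collects contributions over every
  representative \<open>u\<close> of the base point. The values \<open>z\<close> and
  \<open>w\<close> are transported separately to \<open>u\<close> by \<open>R_total\<close>, and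
  \<open>R_free\<close> forces any value of the class at \<open>u\<close> to be the sum of the two
  results.\<close>

lemma fibre_add_cls:
  assumes "v \<in> topspace X"
  shows "fibre_add (quotient_bundle X R B p) (cls (v, z)) (cls (v, w)) = cls (v, z + w)"
proof -
  have "(u, c) \<in> cls (v, z + w) \<longleftrightarrow> (\<exists>a b. c = a + b \<and> (u, a) \<in> cls (v, z) \<and> (u, b) \<in> cls (v, w))" for u c
  proof
    assume "(u, c) \<in> cls (v, z + w)"
    then have R: "((v, z + w), (u, c)) \<in> R" by simp
    then obtain a b where ab: "((v, z), (u, a)) \<in> R" "((v, w), (u, b)) \<in> R"
      using R_total R_fibre R_topspace by meson
    from R R_add [OF ab] have "((u, c), (u, a + b)) \<in> R"
      using equiv_R by (meson equivE symE transE)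
    then show "\<exists>a b. c = a + b \<and> (u, a) \<in> cls (v, z) \<and> (u, b) \<in> cls (v, w)"
      using ab R_free by blast
  qed (auto intro: R_add)
  then show ?thesis
    by (auto simp: quotient_bundle_def)
qed

lemma fibre_scale_cls:
  assumes "v \<in> topspace X"
  shows "fibre_scale (quotient_bundle X R B p) w (cls (v, z)) = cls (v, w * z)"
proof -
  have "(u, c) \<in> cls (v, w * z) \<longleftrightarrow> (\<exists>a. c = w * a \<and> (u, a) \<in> cls (v, z))" for u c
  proof
    assume "(u, c) \<in> cls (v, w * z)"
    then have R: "((v, w * z), (u, c)) \<in> R" by simp
    then obtain a where a: "((v, z), (u, a)) \<in> R"
      using R_total R_fibre R_topspace by meson
    from R R_scale [OF a, of w] have "((u, c), (u, w * a)) \<in> R"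
      using equiv_R by (meson equivE symE transE)
    then show "\<exists>a. c = w * a \<and> (u, a) \<in> cls (v, z)"
      using a R_free by blast
  qed (auto intro: R_scale)
  then show ?thesis
    by (auto simp: quotient_bundle_def)
qed

lemma continuous_proj: "continuous_map (total (quotient_bundle X R B p)) B (proj (quotient_bundle X R B p))"
proof (rule continuous_compose_quotient_map [OF quotient_map_cls])
  have "continuous_map Q B (p \<circ> fst)"
    by (rule continuous_map_compose [OF continuous_map_fst p_cont])
  then show "continuous_map Q B (proj (quotient_bundle X R B p) \<circ> cls)"
    by (rule continuous_map_eq) (auto simp: proj_cls)
qed

text \<open>On an open set \<open>W\<close> where \<open>p\<close> is injective, the inverse
  \<sigma> of \<open>p\<close> picks one representative of each base point. Sending
  \<open>(u, z)\<close> to the class of \<open>(\<sigma> u, z)\<close> is then a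
  trivialization.\<close>

lemma complex_line_bundle_quotient: "complex_line_bundle (quotient_bundle X R B p)"
  unfolding complex_line_bundle_def
proof (intro conjI ballI)
  let ?E = "quotient_bundle X R B p"
  have base: "base ?E = B" by (simp add: quotient_bundle_def)
  show "continuous_map (total ?E) (base ?E) (proj ?E)"
    using continuous_proj by (simp add: base)
  fix b assume "b \<in> topspace (base ?E)"
  then obtain W where W: "openin X W" "b \<in> p ` W" "inj_on p W"
    using p_local unfolding base by blast
  have Wsub: "W \<subseteq> topspace X" using openin_subset W by blast
  let ?U = "p ` W"
  have U: "openin B ?U" using p_open W by (simp add: open_map_def)
  have Usub: "?U \<subseteq> topspace B" using openin_subset U by blast
  have "homeomorphic_map (subtopology X W) (subtopology B ?U) p"
  proof (rule bijective_open_imp_homeomorphic_map)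
    show "continuous_map (subtopology X W) (subtopology B (p ` W)) p"
      using p_cont by (auto simp: continuous_map_in_subtopology continuous_map_from_subtopology)
    show "open_map (subtopology X W) (subtopology B (p ` W)) p"
      by (rule open_map_into_subtopology) (use p_open W in \<open>auto intro: open_map_from_subtopology\<close>)
  qed (use W Wsub Usub in \<open>auto simp: Int_absorb1\<close>)
  then obtain \<sigma> where \<sigma>: "homeomorphic_maps (subtopology X W) (subtopology B ?U) p \<sigma>"
    using homeomorphic_map_maps by blast
  have \<sigma>_cont: "continuous_map (subtopology B ?U) X \<sigma>"
    using \<sigma> by (auto simp: homeomorphic_maps_def continuous_map_in_subtopology)
  have \<sigma>p: "\<sigma> (p v) = v" if "v \<in> W" for v
    using \<sigma> that Wsub by (auto simp: homeomorphic_maps_def)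
  have p\<sigma>: "p (\<sigma> u) = u" "\<sigma> u \<in> W" "\<sigma> u \<in> topspace X" if "u \<in> ?U" for u
    using that \<sigma>p Wsub by auto
  let ?T = "prod_topology (subtopology B ?U) (euclidean :: complex topology)"
  define \<psi> where "\<psi> = (\<lambda>(u, z). cls (\<sigma> u, z))"
  let ?EU = "{e \<in> topspace (total ?E). proj ?E e \<in> ?U}"
  have cls_in: "cls (v, z) \<in> topspace (total ?E)" if "v \<in> topspace X" for v z
    using that by (auto simp: topspace_total intro: quotientI)
  have "homeomorphic_map ?T (subtopology (total ?E) ?EU) \<psi>"
  proof (rule bijective_open_imp_homeomorphic_map)
    have "continuous_map ?T Q (\<lambda>x. (\<sigma> (fst x), snd x))"
      using continuous_map_compose [OF continuous_map_fst \<sigma>_cont]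
      by (intro continuous_map_pairedI continuous_map_snd) (simp add: comp_def)
    from continuous_map_compose [OF this quotient_imp_continuous_map [OF quotient_map_cls]]
    have "continuous_map ?T (total ?E) \<psi>"
      by (simp add: \<psi>_def comp_def case_prod_unfold)
    then show "continuous_map ?T (subtopology (total ?E) ?EU) \<psi>"
      using p\<sigma> Usub by (auto simp: continuous_map_in_subtopology \<psi>_def proj_cls cls_in)
  next
    \<comment> \<open>Openness is moved up to the product: the image of \<open>V\<close> is the
      class image of its pullback to \<open>W\<close>, and the class map is open.\<close>
    have "openin (total ?E) (\<psi> ` V)" if V: "openin ?T V" for V
    proof -
      let ?V' = "{x \<in> topspace (prod_topology (subtopology X W) euclidean). (p (fst x), snd x) \<in> V}"
      have "continuous_map (subtopology X W) (subtopology B ?U) p"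
        using \<sigma> by (simp add: homeomorphic_maps_def)
      from continuous_map_compose [OF continuous_map_fst this]
      have "continuous_map (prod_topology (subtopology X W) euclidean) ?T (\<lambda>x. (p (fst x), snd x))"
        by (intro continuous_map_pairedI continuous_map_snd) (simp add: comp_def)
      then have "openin (prod_topology (subtopology X W) euclidean) ?V'"
        using V by (rule openin_continuous_map_preimage)
      moreover have "prod_topology (subtopology X W) euclidean = subtopology Q (W \<times> UNIV)"
        by (simp add: prod_topology_subtopology)
      moreover have "openin Q (W \<times> UNIV)"
        using W by (simp add: openin_prod_Times_iff)
      ultimately have V': "openin Q ?V'"
        using openin_trans_full [of Q "W \<times> UNIV" ?V'] by simp
      have "\<psi> ` V = cls ` ?V'"
      proof (intro equalityI subsetI)
        fix y assume "y \<in> \<psi> ` V"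
        then obtain u z where uz: "(u, z) \<in> V" "y = cls (\<sigma> u, z)"
          by (auto simp: \<psi>_def)
        then have "u \<in> ?U" using openin_subset [OF V] by auto
        then show "y \<in> cls ` ?V'"
          using uz p\<sigma> by (intro image_eqI [of _ _ "(\<sigma> u, z)"]) auto
      next
        fix y assume "y \<in> cls ` ?V'"
        then obtain v z where vz: "v \<in> W" "(p v, z) \<in> V" "y = cls (v, z)"
          by auto
        then show "y \<in> \<psi> ` V"
          by (intro image_eqI [of _ _ "(p v, z)"]) (auto simp: \<psi>_def \<sigma>p)
      qed
      then show ?thesis using open_map_cls V' by (simp add: open_map_def)
    qed
    then have "open_map ?T (total ?E) \<psi>"
      by (auto simp: open_map_def)
    moreover have "\<psi> ` topspace ?T \<subseteq> ?EU"
      using p\<sigma> Usub by (auto simp: \<psi>_def proj_cls cls_in)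
    ultimately show "open_map ?T (subtopology (total ?E) ?EU) \<psi>"
      by (intro open_map_into_subtopology) (simp_all add: image_subset_iff_funcset)
  next
    show "\<psi> ` topspace ?T = topspace (subtopology (total ?E) ?EU)"
    proof (intro equalityI subsetI)
      fix y assume "y \<in> \<psi> ` topspace ?T"
      then show "y \<in> topspace (subtopology (total ?E) ?EU)"
        using p\<sigma> Usub by (auto simp: \<psi>_def proj_cls cls_in)
    next
      fix y assume y: "y \<in> topspace (subtopology (total ?E) ?EU)"
      then obtain v z where v: "v \<in> topspace X" "y = cls (v, z)"
        unfolding topspace_subtopology topspace_total by (auto elim!: quotientE)
      then have pv: "p v \<in> ?U" using y proj_cls by auto
      \<comment> \<open>Surjectivity: a vector at any \<open>v\<close> over the chart is transported
        to the representative of its base point in the sheet \<open>W\<close>.\<close>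
      then obtain a where "((v, z), (\<sigma> (p v), a)) \<in> R"
        using R_total [OF v(1) p\<sigma>(3) [OF pv]] p\<sigma>(1) [OF pv] by metis
      then have "y = \<psi> (p v, a)"
        using v p\<sigma>(3) [OF pv] by (simp add: \<psi>_def cls_eq_iff)
      then show "y \<in> \<psi> ` topspace ?T"
        using pv Usub by auto
    qed
    show "inj_on \<psi> (topspace ?T)"
    proof (rule inj_onI, clarsimp simp: \<psi>_def)
      fix v w z z' assume vw: "v \<in> W" "w \<in> W" "cls (\<sigma> (p v), z) = cls (\<sigma> (p w), z')"
      then have R: "((v, z), (w, z')) \<in> R"
        using cls_eq_iff [of v w z z'] Wsub by (auto simp: \<sigma>p)
      \<comment> \<open>Two points of \<open>W\<close> with equal image coincide, and over a single
        point \<open>R_free\<close> allows only equal values.\<close>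
      then have "p v = p w" by (rule R_fibre)
      moreover from this have "v = w" using vw \<sigma>p by metis
      ultimately show "p v = p w \<and> z = z'" using R R_free by blast
    qed
  qed
  moreover have "proj ?E (\<psi> (u, z)) = u \<and> fibre_add ?E (\<psi> (u, z)) (\<psi> (u, w)) = \<psi> (u, z + w) \<and>
        fibre_scale ?E w (\<psi> (u, z)) = \<psi> (u, w * z)" if "u \<in> ?U" for u z w
    using p\<sigma> [OF that] by (simp add: \<psi>_def proj_cls fibre_add_cls fibre_scale_cls)
  ultimately show "\<exists>U \<psi>. openin (base ?E) U \<and> b \<in> U \<and>
        homeomorphic_map (prod_topology (subtopology (base ?E) U) euclidean)
          (subtopology (total ?E) {e \<in> topspace (total ?E). proj ?E e \<in> U}) \<psi> \<and>
        (\<forall>u\<in>U. \<forall>z w. proj ?E (\<psi> (u, z)) = u \<and>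
           fibre_add ?E (\<psi> (u, z)) (\<psi> (u, w)) = \<psi> (u, z + w) \<and>
           fibre_scale ?E w (\<psi> (u, z)) = \<psi> (u, w * z))"
    unfolding base using U W(2) by blast
qed

text \<open>Rescaling by \<open>g\<close> over the homeomorphism \<Phi> carries \<open>R\<close>
  exactly onto \<open>R'\<close>, so it maps classes onto classes. The resulting bundle map is
  therefore the image operation on sets, and the vector space operations are preserved because
  multiplication by \<open>g\<close> is linear.\<close>

lemma quotient_bundle_iso:
  fixes X' :: "'y topology" and B' :: "'d topology"
  assumes \<Phi>: "homeomorphic_map X X' \<Phi>"
    and g: "continuous_map X euclidean g" "\<And>v. v \<in> topspace X \<Longrightarrow> g v \<noteq> 0"
    and \<beta>: "homeomorphic_map B B' \<beta>" "\<And>v. v \<in> topspace X \<Longrightarrow> \<beta> (p v) = p' (\<Phi> v)"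
    and R': "R' = {((\<Phi> v, z * g v), (\<Phi> w, c * g w)) | v z w c. ((v, z), (w, c)) \<in> R}"
  shows "line_bundle_iso_over \<beta> (quotient_bundle X R B p) (quotient_bundle X' R' B' p')
           ((`) (\<lambda>(v, z). (\<Phi> v, z * g v)))"
proof -
  let ?E = "quotient_bundle X R B p" and ?F = "quotient_bundle X' R' B' p'"
  let ?\<Psi> = "\<lambda>(v, z). (\<Phi> v, z * g v)"
  let ?Q' = "prod_topology X' (euclidean :: complex topology)"
  have inj: "v = w" if "\<Phi> v = \<Phi> w" "v \<in> topspace X" "w \<in> topspace X" for v w
    using homeomorphic_imp_injective_map [OF \<Phi>] that by (simp add: inj_on_def)
  have cls': "R' `` {(\<Phi> v, z * g v)} = ?\<Psi> ` cls (v, z)" if v: "v \<in> topspace X" for v z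
  proof (intro equalityI subsetI)
    fix y assume "y \<in> R' `` {(\<Phi> v, z * g v)}"
    \<comment> \<open>The pair of \<open>R'\<close> could a priori come from another point
      \<open>(v', z')\<close>. Injectivity of \<Phi> and the nonvanishing of \<open>g\<close>
      identify it with \<open>(v, z)\<close>.\<close>
    then obtain v' z' w c where *: "((v', z'), (w, c)) \<in> R" "\<Phi> v = \<Phi> v'" "z * g v = z' * g v'" "y = (\<Phi> w, c * g w)"
      unfolding R' by auto
    then have "v = v'" using v R_topspace inj by blast
    then have "z = z'" using * g(2) [OF v] by simp
    then show "y \<in> ?\<Psi> ` cls (v, z)"
      using * \<open>v = v'\<close> by (auto intro!: image_eqI [of _ _ "(w, c)"])
  next
    fix y assume "y \<in> ?\<Psi> ` cls (v, z)"
    then show "y \<in> R' `` {(\<Phi> v, z * g v)}"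
      unfolding R' by auto
  qed
  have \<Psi>_inj: "inj_on ?\<Psi> (topspace X \<times> UNIV)"
  proof (rule inj_onI, clarsimp)
    fix v w z c assume "v \<in> topspace X" "w \<in> topspace X" "\<Phi> v = \<Phi> w" "z * g v = c * g w"
    moreover from this have "v = w" using inj by blast
    ultimately show "v = w \<and> z = c" using g(2) by simp
  qed
  have \<Psi>_homeo: "homeomorphic_map Q ?Q' ?\<Psi>"
  proof -
    obtain \<Theta> where \<Theta>: "homeomorphic_maps X X' \<Phi> \<Theta>"
      using \<Phi> homeomorphic_map_maps by blast
    have c1: "continuous_map X X' \<Phi>" "continuous_map X' X \<Theta>"
      and inv1: "\<And>x. x \<in> topspace X \<Longrightarrow> \<Theta> (\<Phi> x) = x" "\<And>x. x \<in> topspace X' \<Longrightarrow> \<Phi> (\<Theta> x) = x"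
      using \<Theta> by (auto simp: homeomorphic_maps_def)
    have in1: "\<Theta> x \<in> topspace X" if "x \<in> topspace X'" for x
      using c1(2) that by (auto simp: continuous_map_def)
    have "continuous_map Q ?Q' (\<lambda>x. (\<Phi> (fst x), snd x * g (fst x)))"
      using continuous_map_compose [OF continuous_map_fst c1(1)] continuous_map_compose [OF continuous_map_fst g(1)]
      by (intro continuous_map_pairedI continuous_map_mult continuous_map_snd) (auto simp: comp_def)
    \<comment> \<open>The inverse divides by \<open>g\<close> at the preimage point; since
      \<open>g\<close> has no zeros, \<open>inverse\<close> stays where it is continuous.\<close>
    moreover have "continuous_map ?Q' Q (\<lambda>y. (\<Theta> (fst y), snd y * inverse (g (\<Theta> (fst y)))))"
      using continuous_map_compose [OF continuous_map_fst c1(2)]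
        continuous_map_compose [OF continuous_map_fst continuous_map_compose [OF c1(2) g(1)]] g(2) in1
      by (intro continuous_map_pairedI continuous_map_mult continuous_map_snd
          continuous_map_comp_on [where h = inverse and A = "UNIV - {0}"] continuous_on_inverse continuous_on_id)
        (auto simp: comp_def)
    ultimately have "homeomorphic_maps Q ?Q' (\<lambda>x. (\<Phi> (fst x), snd x * g (fst x)))
        (\<lambda>y. (\<Theta> (fst y), snd y * inverse (g (\<Theta> (fst y)))))"
      using inv1 in1 g(2) by (auto simp: homeomorphic_maps_def)
    then show ?thesis
      using homeomorphic_maps_map by (fastforce simp: case_prod_unfold)
  qed
  have total: "homeomorphic_map (total ?E) (total ?F) ((`) ?\<Psi>)"
  proof (rule homeomorphic_map_between_quotients [OF quotient_map_cls _ \<Psi>_homeo])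
    show "quotient_map ?Q' (total ?F) (\<lambda>y. R' `` {y})"
      using quotient_map_class by (simp add: quotient_bundle_def)
    show "?\<Psi> ` cls x = R' `` {?\<Psi> x}" if "x \<in> topspace Q" for x
      using that by (cases x) (simp add: cls')
    fix x y assume xy: "x \<in> topspace Q" "y \<in> topspace Q"
    \<comment> \<open>Classes stay inside the set on which the rescaling is injective, so equality
      of image sets reflects equality of classes.\<close>
    have "R `` {x} \<subseteq> topspace X \<times> UNIV" "R `` {y} \<subseteq> topspace X \<times> UNIV"
      using R_topspace by (cases x; cases y; fastforce)+
    then show "(cls x = cls y) = (R' `` {?\<Psi> x} = R' `` {?\<Psi> y})"
      using xy by (cases x; cases y) (simp add: cls' inj_on_image_eq_iff [OF \<Psi>_inj])
  qed
  have total_cases: thesis if "e \<in> topspace (total ?E)" "\<And>v z. v \<in> topspace X \<Longrightarrow> e = cls (v, z) \<Longrightarrow> thesis" for e thesis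
    using that unfolding topspace_total by (auto elim!: quotientE)
  have projF: "proj ?F (?\<Psi> ` e) = \<beta> (proj ?E e)" if e: "e \<in> topspace (total ?E)" for e
  proof -
    obtain v z where v: "v \<in> topspace X" "e = cls (v, z)"
      using total_cases [OF e] by blast
    have "(SOME y. y \<in> ?\<Psi> ` e) \<in> ?\<Psi> ` e"
      unfolding v(2) using imageI [OF cls_self [OF v(1), of z]] by (rule someI)
    then obtain w c where w: "((v, z), (w, c)) \<in> R" "(SOME y. y \<in> ?\<Psi> ` e) = (\<Phi> w, c * g w)"
      using v by auto
    then have "proj ?F (?\<Psi> ` e) = p' (\<Phi> w)"
      by (simp add: quotient_bundle_def)
    also have "\<dots> = \<beta> (p v)"
      using \<beta>(2) R_topspace [OF w(1)] R_fibre [OF w(1)] by simp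
    finally show ?thesis using v by (simp add: proj_cls)
  qed
  have addF: "?\<Psi> ` fibre_add ?E d e = fibre_add ?F (?\<Psi> ` d) (?\<Psi> ` e)"
    if d: "d \<in> topspace (total ?E)" and e: "e \<in> topspace (total ?E)" for d e
  proof -
    have sub: "v \<in> topspace X" if "(v, z) \<in> d \<or> (v, z) \<in> e" for v z
      using that d e R_topspace by (auto elim!: total_cases)
    show ?thesis
    proof (intro equalityI subsetI)
      fix y assume "y \<in> ?\<Psi> ` fibre_add ?E d e"
      then obtain v z w where "(v, z) \<in> d" "(v, w) \<in> e" "y = (\<Phi> v, z * g v + w * g v)"
        by (auto simp: quotient_bundle_def distrib_right)
      then show "y \<in> fibre_add ?F (?\<Psi> ` d) (?\<Psi> ` e)"
        unfolding quotient_bundle_def by (force simp: image_iff)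
    next
      fix y assume "y \<in> fibre_add ?F (?\<Psi> ` d) (?\<Psi> ` e)"
      then obtain v z w c where *: "(v, z) \<in> d" "(w, c) \<in> e" "\<Phi> v = \<Phi> w" "y = (\<Phi> v, z * g v + c * g w)"
        by (auto simp: quotient_bundle_def)
      \<comment> \<open>\<open>fibre_add\<close> combines values over a common point. In
        \<open>F\<close> this is a common point of \<open>X'\<close>, which injectivity of \<Phi>
        turns into a common point of \<open>X\<close>.\<close>
      then have "v = w" using inj sub by blast
      with * have "y = ?\<Psi> (v, z + c)" "(v, z + c) \<in> fibre_add ?E d e"
        by (auto simp: quotient_bundle_def distrib_right)
      then show "y \<in> ?\<Psi> ` fibre_add ?E d e" by blast
    qed
  qed
  have scaleF: "?\<Psi> ` fibre_scale ?E a e = fibre_scale ?F a (?\<Psi> ` e)" for a e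
    by (force simp: quotient_bundle_def image_iff mult.assoc)
  have \<beta>': "homeomorphic_map (base ?E) (base ?F) \<beta>"
    using \<beta>(1) by (simp add: quotient_bundle_def)
  show ?thesis
    unfolding line_bundle_iso_over_def
    using complex_line_bundle_quotient complex_line_bundle_transport [OF complex_line_bundle_quotient \<beta>' total projF addF scaleF]
      \<beta>' total projF addF scaleF by blast
qed

end

subsection \<open>The topology of the tori and the exponential map\<close>

lemma topspace_tensor_topology:
  assumes "comm_group A"
  shows "topspace (tensor_topology A) = carrier (tensor_group A)"
  using tensor_eval_closed [OF assms]
  by (auto simp: tensor_topology_def topspace_pullback_topology PiE_iff)

text \<open>The tensor topology is initial for the joint evaluation map, and continuity into a
  product is componentwise.\<close>

lemma continuous_map_into_tensor_topology:
  assumes A: "comm_group A" and f: "\<And>z. z \<in> topspace Z \<Longrightarrow> f z \<in> carrier (tensor_group A)"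
    and cont: "\<And>l. l \<in> dual_lattice \<Longrightarrow> continuous_map Z euclidean (\<lambda>z. tensor_eval A l (f z))"
  shows "continuous_map Z (tensor_topology A) f"
  unfolding tensor_topology_def
proof (rule continuous_map_pullback')
  have "continuous_map Z (top_of_set (carrier A)) (\<lambda>z. tensor_eval A l (f z))" if "l \<in> dual_lattice" for l
    using cont [OF that] tensor_eval_closed [OF A that f] by (auto simp: continuous_map_in_subtopology)
  then show "continuous_map Z (product_topology (\<lambda>_. top_of_set (carrier A)) dual_lattice)
      ((\<lambda>X. \<lambda>l\<in>dual_lattice. tensor_eval A l X) \<circ> f)"
    by (auto simp: continuous_map_componentwise comp_def PiE_iff)
qed (use f in auto)

lemma continuous_map_tensor_eval:
  assumes "l \<in> dual_lattice"
  shows "continuous_map (tensor_topology A) euclidean (tensor_eval A l)"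
proof -
  have "continuous_map (product_topology (\<lambda>_. top_of_set (carrier A)) dual_lattice) (top_of_set (carrier A)) (\<lambda>x. x l)"
    using assms by (rule continuous_map_product_projection)
  from continuous_map_pullback [OF this]
  have "continuous_map (tensor_topology A) (top_of_set (carrier A)) ((\<lambda>x. x l) \<circ> (\<lambda>X. \<lambda>l\<in>dual_lattice. tensor_eval A l X))"
    unfolding tensor_topology_def .
  then show ?thesis
    using assms by (simp add: comp_def continuous_map_in_subtopology)
qed

section \<open>The exponential function and evaluation on the vector space and the tori\<close>

lemma e2pii_add: "e2pii (a + b) = e2pii a * e2pii b"
  by (simp add: e2pii_def exp_add [symmetric] distrib_left)

lemma e2pii_nonzero [simp]: "e2pii a \<noteq> 0"
  by (simp add: e2pii_def)

lemma e2pii_0 [simp]: "e2pii 0 = 1"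
  by (simp add: e2pii_def)

lemma norm_e2pii: "norm (e2pii a) = exp (- (2 * pi * Im a))"
  by (simp add: e2pii_def)

lemma norm_e2pii_of_real [simp]: "norm (e2pii (of_real r)) = 1"
  by (simp add: norm_e2pii)

lemma e2pii_of_int [simp]: "e2pii (of_int k) = 1"
  unfolding e2pii_def exp_eq_1 by (auto intro: exI [of _ k])

lemma e2pii_eq_1_iff: "e2pii (of_real r) = 1 \<longleftrightarrow> r \<in> \<int>"
proof -
  have "2 * r * pi = real_of_int (2 * n) * pi \<longleftrightarrow> r = of_int n" for n
    by simp
  then show ?thesis
    unfolding e2pii_def exp_eq_1 Ints_def by (auto simp: mult_ac)
qed

lemma e2pii_diff: "e2pii (a - b) = e2pii a / e2pii b"
  using e2pii_add [of "a - b" b] by simp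

lemma continuous_on_e2pii: "continuous_on UNIV e2pii"
  unfolding e2pii_def by (intro continuous_intros)

text \<open>The polar form of \<open>z\<close> with the angle measured in full turns. It provides
  the preimages under \<open>exp_T\<close>, coordinate by coordinate.\<close>

lemma e2pii_Arg: "z \<noteq> 0 \<Longrightarrow> e2pii (of_real (Arg z / (2 * pi))) = z / of_real (norm z)"
  using Arg_eq [of z] by (simp add: e2pii_def field_simps)

lemma e2pii_real_hom: "(\<lambda>r. e2pii (of_real r)) \<in> hom additive_group circle_group"
  by (intro homI) (auto simp: e2pii_add)

lemma e2pii_hom: "e2pii \<in> hom additive_group Cstar_group"
  by (intro homI) (auto simp: e2pii_add)

lemma t_group_simps [simp]: "comm_group t_group" "comm_group T_group" "comm_group TC_group" "comm_group tC_group"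
  by (simp_all add: t_group_def T_group_def TC_group_def tC_group_def comm_group_tensor_group)

lemma topspace_t_top [simp]: "topspace t_top = carrier t_group"
  and topspace_T_top [simp]: "topspace T_top = carrier T_group"
  and topspace_TC_top [simp]: "topspace TC_top = carrier TC_group"
  by (simp_all add: t_top_def T_top_def TC_top_def t_group_def T_group_def TC_group_def topspace_tensor_topology)

abbreviation t_eval :: "('l::ab_group_add \<Rightarrow> int) \<Rightarrow> ('l, real) tensor \<Rightarrow> real" where
  "t_eval \<equiv> tensor_eval additive_group"

abbreviation T_eval :: "('l::ab_group_add \<Rightarrow> int) \<Rightarrow> ('l, complex) tensor \<Rightarrow> complex" where
  "T_eval \<equiv> tensor_eval circle_group"

abbreviation TC_eval :: "('l::ab_group_add \<Rightarrow> int) \<Rightarrow> ('l, complex) tensor \<Rightarrow> complex" where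
  "TC_eval \<equiv> tensor_eval Cstar_group"

lemma t_mult_closed [simp]:
  "x \<in> carrier t_group \<Longrightarrow> y \<in> carrier t_group \<Longrightarrow> x \<otimes>\<^bsub>t_group\<^esub> y \<in> carrier t_group"
  and TC_mult_closed [simp]:
  "h \<in> carrier TC_group \<Longrightarrow> k \<in> carrier TC_group \<Longrightarrow> h \<otimes>\<^bsub>TC_group\<^esub> k \<in> carrier TC_group"
  by (simp_all add: comm_groupE(1))

lemma t_eval_mult:
  "l \<in> dual_lattice \<Longrightarrow> x \<in> carrier t_group \<Longrightarrow> y \<in> carrier t_group \<Longrightarrow>
     t_eval l (x \<otimes>\<^bsub>t_group\<^esub> y) = t_eval l x + t_eval l y"
  by (simp add: t_group_def tensor_eval_mult)

lemma TC_eval_mult: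
  "l \<in> dual_lattice \<Longrightarrow> x \<in> carrier TC_group \<Longrightarrow> y \<in> carrier TC_group \<Longrightarrow>
     TC_eval l (x \<otimes>\<^bsub>TC_group\<^esub> y) = TC_eval l x * TC_eval l y"
  by (simp add: TC_group_def tensor_eval_mult)

lemma norm_T_eval: "l \<in> dual_lattice \<Longrightarrow> s \<in> carrier T_group \<Longrightarrow> norm (T_eval l s) = 1"
  using tensor_eval_closed [of circle_group l s] by (simp add: T_group_def)

lemma T_eval_nonzero: "l \<in> dual_lattice \<Longrightarrow> s \<in> carrier T_group \<Longrightarrow> T_eval l s \<noteq> 0"
  using norm_T_eval by fastforce

lemma TC_eval_nonzero: "l \<in> dual_lattice \<Longrightarrow> h \<in> carrier TC_group \<Longrightarrow> TC_eval l h \<noteq> 0"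
  using tensor_eval_closed [of Cstar_group l h] by (simp add: TC_group_def)

lemma exp_T_closed: "x \<in> carrier t_group \<Longrightarrow> exp_T x \<in> carrier T_group"
  unfolding exp_T_def t_group_def T_group_def by (rule tensor_map_closed [OF _ _ e2pii_real_hom]) auto

lemma T_eval_exp_T:
  "l \<in> dual_lattice \<Longrightarrow> x \<in> carrier t_group \<Longrightarrow> T_eval l (exp_T x) = e2pii (of_real (t_eval l x))"
  unfolding exp_T_def t_group_def by (subst tensor_eval_map [OF _ _ e2pii_real_hom]) auto

lemma in_t_closed [simp]: "in_t m \<in> carrier t_group"
  unfolding in_t_def t_group_def by (rule pure_tensor_closed) simp

lemma t_eval_in_t: "l \<in> dual_lattice \<Longrightarrow> t_eval l (in_t m) = of_int (l m)"
  by (simp add: in_t_def tensor_eval_pure additive_int_pow)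

lemma continuous_t_eval: "l \<in> dual_lattice \<Longrightarrow> continuous_map t_top euclidean (t_eval l)"
  and continuous_T_eval: "l \<in> dual_lattice \<Longrightarrow> continuous_map T_top euclidean (T_eval l)"
  and continuous_TC_eval: "l \<in> dual_lattice \<Longrightarrow> continuous_map TC_top euclidean (TC_eval l)"
  by (simp_all add: t_top_def T_top_def TC_top_def continuous_map_tensor_eval)

lemma continuous_map_into_t:
  "(\<And>z. z \<in> topspace Z \<Longrightarrow> f z \<in> carrier t_group) \<Longrightarrow>
   (\<And>l. l \<in> dual_lattice \<Longrightarrow> continuous_map Z euclidean (\<lambda>z. t_eval l (f z))) \<Longrightarrow> continuous_map Z t_top f"
  and continuous_map_into_T:
  "(\<And>z. z \<in> topspace Z \<Longrightarrow> g z \<in> carrier T_group) \<Longrightarrow>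
   (\<And>l. l \<in> dual_lattice \<Longrightarrow> continuous_map Z euclidean (\<lambda>z. T_eval l (g z))) \<Longrightarrow> continuous_map Z T_top g"
  and continuous_map_into_TC:
  "(\<And>z. z \<in> topspace Z \<Longrightarrow> g z \<in> carrier TC_group) \<Longrightarrow>
   (\<And>l. l \<in> dual_lattice \<Longrightarrow> continuous_map Z euclidean (\<lambda>z. TC_eval l (g z))) \<Longrightarrow> continuous_map Z TC_top g"
  unfolding t_top_def T_top_def TC_top_def t_group_def T_group_def TC_group_def
  by (rule continuous_map_into_tensor_topology; simp)+

lemma continuous_exp_T: "continuous_map t_top T_top exp_T"
proof (rule continuous_map_into_T)
  fix l :: "'a \<Rightarrow> int" assume l: "l \<in> dual_lattice"
  have "continuous_map t_top euclidean (\<lambda>x. e2pii (of_real (t_eval l x)))"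
    by (rule continuous_map_comp_on [OF continuous_t_eval [OF l], of UNIV "\<lambda>r. e2pii (of_real r)"])
      (auto intro!: continuous_on_compose2 [OF continuous_on_e2pii] continuous_intros)
  then show "continuous_map t_top euclidean (\<lambda>x. T_eval l (exp_T x))"
    by (rule continuous_map_eq) (simp add: T_eval_exp_T l)
qed (simp add: exp_T_closed)

section \<open>The exponential from the vector space to the compact torus as a covering\<close>

lemma openin_finite_ball:
  assumes "finite S" "\<And>i. i \<in> S \<Longrightarrow> openin X {x \<in> topspace X. P i x}"
  shows "openin X {x \<in> topspace X. \<forall>i\<in>S. P i x}"
  using assms
proof (induction S rule: finite_induct)
  case (insert i S)
  then have "openin X ({x \<in> topspace X. P i x} \<inter> {x \<in> topspace X. \<forall>i\<in>S. P i x})"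
    by (intro openin_Int) auto
  moreover have "{x \<in> topspace X. P i x} \<inter> {x \<in> topspace X. \<forall>i\<in>S. P i x} = {x \<in> topspace X. \<forall>i\<in>insert i S. P i x}"
    by auto
  ultimately show ?case by simp
qed auto

context lattice_basis
begin

lemma t_eqI:
  assumes "x \<in> carrier t_group" "y \<in> carrier t_group" "\<And>i. i \<in> S \<Longrightarrow> t_eval (c i) x = t_eval (c i) y"
  shows "x = y"
  using assms unfolding t_group_def by (intro tensor_eqI_basis [OF comm_group_additive_group])

lemma T_eqI:
  assumes "s \<in> carrier T_group" "s' \<in> carrier T_group" "\<And>i. i \<in> S \<Longrightarrow> T_eval (c i) s = T_eval (c i) s'"
  shows "s = s'"
  using assms unfolding T_group_def by (intro tensor_eqI_basis [OF comm_group_circle_group])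

lemma TC_eqI:
  assumes "h \<in> carrier TC_group" "k \<in> carrier TC_group" "\<And>i. i \<in> S \<Longrightarrow> TC_eval (c i) h = TC_eval (c i) k"
  shows "h = k"
  using assms unfolding TC_group_def by (intro tensor_eqI_basis [OF comm_group_Cstar_group])

text \<open>The kernel of \<open>exp_T\<close> is the lattice: equal images mean that all
  coordinates differ by integers, and \<open>lattice_element_exists\<close> realises these integers
  by one lattice vector.\<close>

lemma exp_T_eq_iff:
  fixes x y :: "('l, real) tensor"
  assumes x: "x \<in> carrier t_group" and y: "y \<in> carrier t_group"
  shows "exp_T x = exp_T y \<longleftrightarrow> (\<exists>m. x = y \<otimes>\<^bsub>t_group\<^esub> in_t m)"
proof
  assume eq: "exp_T x = exp_T y"
  have "\<exists>n :: int. t_eval (c i) x = t_eval (c i) y + of_int n" if "i \<in> S" for i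
  proof -
    have "e2pii (of_real (t_eval (c i) x)) = e2pii (of_real (t_eval (c i) y))"
      using eq T_eval_exp_T [OF c_dual [OF that]] x y by metis
    then have "e2pii (of_real (t_eval (c i) x - t_eval (c i) y)) = 1"
      by (simp add: e2pii_diff)
    then obtain n :: int where "t_eval (c i) x - t_eval (c i) y = of_int n"
      unfolding e2pii_eq_1_iff by (auto elim: Ints_cases)
    then show ?thesis by (intro exI [of _ n]) simp
  qed
  then obtain n :: "nat \<Rightarrow> int" where n: "\<And>i. i \<in> S \<Longrightarrow> t_eval (c i) x = t_eval (c i) y + of_int (n i)"
    by metis
  obtain m where m: "\<forall>i\<in>S. c i m = n i"
    using lattice_element_exists by blast
  have "x = y \<otimes>\<^bsub>t_group\<^esub> in_t m"
    using x y n m by (intro t_eqI) (auto simp: t_eval_mult t_eval_in_t c_dual)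
  then show "\<exists>m. x = y \<otimes>\<^bsub>t_group\<^esub> in_t m" ..
next
  assume "\<exists>m. x = y \<otimes>\<^bsub>t_group\<^esub> in_t m"
  then obtain m where "x = y \<otimes>\<^bsub>t_group\<^esub> in_t m" ..
  then show "exp_T x = exp_T y"
    using x y by (intro T_eqI exp_T_closed)
      (auto simp: T_eval_exp_T t_eval_mult t_eval_in_t c_dual e2pii_add)
qed

lemma in_t_inj:
  assumes "in_t m = in_t (n :: 'l)"
  shows "m = n"
  using assms t_eval_in_t [OF c_dual, of _ m] t_eval_in_t [OF c_dual, of _ n] by (intro lattice_element_unique) auto

text \<open>A branch of the logarithm in each coordinate inverts \<open>exp_T\<close> locally. The
  branch must pass through the given \<open>x\<close>, because the openness criterion wants a
  section through every point.\<close>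

lemma exp_T_local_section:
  fixes x :: "('l, real) tensor"
  assumes x: "x \<in> carrier t_group"
  shows "\<exists>U \<sigma>. openin T_top U \<and> exp_T x \<in> U \<and> continuous_map (subtopology T_top U) t_top \<sigma> \<and>
     (\<forall>s\<in>U. exp_T (\<sigma> s) = s) \<and> \<sigma> (exp_T x) = x"
proof -
  define r where "r i = t_eval (c i) x" for i
  \<comment> \<open>The coordinates of \<open>s\<close> relative to those of \<open>exp_T x\<close>.
    They equal 1 at the centre, so near it they avoid the cut of \<open>Arg\<close>; the offset
    \<open>r i\<close> is added back in \<open>a\<close>.\<close>
  define w where "w i s = T_eval (c i) s * e2pii (of_real (- r i))" for i s
  define U where "U = {s \<in> topspace T_top. \<forall>i\<in>S. w i s \<in> - \<real>\<^sub>\<le>\<^sub>0}"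
  define a where "a s i = r i + Arg (w i s) / (2 * pi)" for s i
  define \<sigma> :: "('l, complex) tensor \<Rightarrow> ('l, real) tensor" where "\<sigma> s = from_coords additive_group (a s)" for s
  have w_cont: "continuous_map T_top euclidean (w i)" if "i \<in> S" for i
    unfolding w_def by (intro continuous_map_mult continuous_T_eval c_dual that) simp
  have w_norm: "norm (w i s) = 1" if "s \<in> carrier T_group" "i \<in> S" for i s
    using that norm_e2pii_of_real [of "- r i"] by (simp add: w_def norm_mult norm_T_eval c_dual del: norm_e2pii_of_real)
  have w_exp: "w i (exp_T x) = 1" if "i \<in> S" for i
    using that x by (simp add: w_def T_eval_exp_T c_dual r_def flip: e2pii_add)
  have U: "openin T_top U"
    unfolding U_def using w_cont open_Compl [OF closed_nonpos_Reals_complex]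
    by (intro openin_finite_ball finite_S openin_continuous_map_preimage) auto
  have \<sigma>_closed: "\<sigma> s \<in> carrier t_group" for s
    unfolding \<sigma>_def t_group_def by (rule from_coords_closed) auto
  have \<sigma>_coord: "t_eval (c i) (\<sigma> s) = a s i" if "i \<in> S" for i s
    unfolding \<sigma>_def using that by (intro tensor_eval_from_coords_basis) auto
  have "exp_T (\<sigma> s) = s" if s: "s \<in> U" for s
  proof (rule T_eqI)
    show sT: "s \<in> carrier T_group" using s by (simp add: U_def)
    fix i assume i: "i \<in> S"
    have "w i s \<noteq> 0" using w_norm [OF sT i] by auto
    then have "e2pii (of_real (a s i)) = e2pii (of_real (r i)) * w i s"
      using e2pii_Arg [of "w i s"] w_norm [OF sT i] by (simp add: a_def e2pii_add)
    also have "\<dots> = T_eval (c i) s"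
      by (simp add: w_def flip: e2pii_add)
    finally show "T_eval (c i) (exp_T (\<sigma> s)) = T_eval (c i) s"
      using i by (simp add: T_eval_exp_T \<sigma>_closed c_dual \<sigma>_coord)
  qed (simp add: exp_T_closed \<sigma>_closed)
  moreover have "\<sigma> (exp_T x) = x"
    using x by (intro t_eqI) (auto simp: \<sigma>_closed \<sigma>_coord a_def w_exp r_def)
  moreover have "exp_T x \<in> U"
    using x by (auto simp: U_def exp_T_closed w_exp)
  moreover have "continuous_map (subtopology T_top U) t_top \<sigma>"
  proof (rule continuous_map_into_t [OF \<sigma>_closed])
    fix l :: "'l \<Rightarrow> int" assume l: "l \<in> dual_lattice"
    have "continuous_map (subtopology T_top U) euclidean (\<lambda>s. Arg (w i s))" if i: "i \<in> S" for i
    proof (rule continuous_map_comp_on [where h = Arg and f = "w i"])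
      show "continuous_map (subtopology T_top U) euclidean (w i)"
        using w_cont [OF i] by (rule continuous_map_from_subtopology)
      show "continuous_on (- \<real>\<^sub>\<le>\<^sub>0) Arg"
        using continuous_at_Arg by (auto intro: continuous_at_imp_continuous_on)
      show "\<And>s. s \<in> topspace (subtopology T_top U) \<Longrightarrow> w i s \<in> - \<real>\<^sub>\<le>\<^sub>0"
        using i by (auto simp: U_def)
    qed
    \<comment> \<open>Continuity into \<open>t_top\<close> concerns every dual functional, and
      \<open>l\<close> is the integral combination of the coordinates with coefficients
      \<open>l (e i)\<close>.\<close>
    then have "continuous_map (subtopology T_top U) euclidean (\<lambda>s. \<Sum>i\<in>S. of_int (l (e i)) * a s i)"
      unfolding a_def divide_inverse by (intro continuous_intros finite_S) (auto intro!: continuous_intros)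
    moreover have "t_eval l (\<sigma> s) = (\<Sum>i\<in>S. of_int (l (e i)) * a s i)" for s
      unfolding \<sigma>_def by (subst tensor_eval_from_coords)
        (auto simp: l finprod_additive_group finite_S additive_int_pow)
    ultimately show "continuous_map (subtopology T_top U) euclidean (\<lambda>s. t_eval l (\<sigma> s))"
      by simp
  qed
  ultimately show ?thesis using U by blast
qed

lemma open_map_exp_T: "open_map t_top T_top (exp_T :: ('l, real) tensor \<Rightarrow> _)"
  by (rule open_map_if_local_sections) (use exp_T_local_section in simp)

lemma exp_T_surj:
  assumes s: "s \<in> carrier T_group"
  obtains y where "y \<in> carrier (t_group :: ('l, real) tensor monoid)" "exp_T y = s"
proof
  define y :: "('l, real) tensor" where "y = from_coords additive_group (\<lambda>i. Arg (T_eval (c i) s) / (2 * pi))"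
  show y: "y \<in> carrier t_group"
    unfolding y_def t_group_def by (rule from_coords_closed) auto
  show "exp_T y = s"
  proof (rule T_eqI [OF exp_T_closed [OF y] s])
    fix i assume i: "i \<in> S"
    have "t_eval (c i) y = Arg (T_eval (c i) s) / (2 * pi)"
      unfolding y_def using i by (intro tensor_eval_from_coords_basis) auto
    then show "T_eval (c i) (exp_T y) = T_eval (c i) s"
      using e2pii_Arg [of "T_eval (c i) s"] i s y
      by (simp add: T_eval_exp_T c_dual T_eval_nonzero norm_T_eval)
  qed
qed

lemma exp_T_locally_inj:
  fixes x :: "('l, real) tensor"
  assumes x: "x \<in> carrier t_group"
  shows "\<exists>W. openin t_top W \<and> x \<in> W \<and> inj_on (exp_T :: ('l, real) tensor \<Rightarrow> _) W"
proof (intro exI conjI)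
  \<comment> \<open>An open box of side 1: two of its points differ by less than 1 in each
    coordinate, whereas points with equal image differ by integers.\<close>
  let ?W = "{y \<in> topspace t_top. \<forall>i\<in>S. t_eval (c i) y \<in> {t_eval (c i) x - 1/2 <..< t_eval (c i) x + 1/2}}"
  show "openin t_top ?W"
    by (intro openin_finite_ball finite_S openin_continuous_map_preimage [OF continuous_t_eval] c_dual) auto
  show "x \<in> ?W" using x by auto
  show "inj_on exp_T ?W"
  proof (rule inj_onI)
    fix y z assume yz: "y \<in> ?W" "z \<in> ?W" "exp_T y = exp_T z"
    then obtain m where m: "y = z \<otimes>\<^bsub>t_group\<^esub> in_t m"
      using exp_T_eq_iff by auto
    have "t_eval (c i) y = t_eval (c i) z" if i: "i \<in> S" for i
    proof -
      have *: "t_eval (c i) y = t_eval (c i) z + of_int (c i m)"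
        using yz i m by (simp add: t_eval_mult t_eval_in_t c_dual)
      have "\<bar>t_eval (c i) y - t_eval (c i) z\<bar> < 1"
      proof -
        have "t_eval (c i) v \<in> {t_eval (c i) x - 1/2 <..< t_eval (c i) x + 1/2}" if "v \<in> ?W" for v
          using that i by blast
        from this [OF yz(1)] this [OF yz(2)] show ?thesis
          by (auto simp: abs_less_iff)
      qed
      then have "\<bar>real_of_int (c i m)\<bar> < 1" using * by simp
      then have "c i m = 0" by linarith
      then show ?thesis using * by simp
    qed
    then show "y = z" using yz by (intro t_eqI) auto
  qed
qed

end

subsection \<open>Polar coordinates on the complex torus\<close>

lemma hom_finprod_additive:
  assumes "h \<in> hom G additive_group" "comm_group G" "f \<in> S \<rightarrow> carrier G" "finite S"
  shows "h (finprod G f S) = (\<Sum>i\<in>S. h (f i))"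
  using hom_finprod [OF assms(1,2) _ assms(3)] assms(4) by (simp add: finprod_additive_group)

lemma in_t_add: "in_t (m + n) = in_t m \<otimes>\<^bsub>t_group\<^esub> in_t n"
  by (simp add: in_t_def t_group_def pure_tensor_add_left)

lemma continuous_translate_t: "continuous_map t_top t_top (\<lambda>x. x \<otimes>\<^bsub>t_group\<^esub> in_t m)"
proof (rule continuous_map_into_t)
  fix l :: "'a \<Rightarrow> int" assume l: "l \<in> dual_lattice"
  have "continuous_map t_top euclidean (\<lambda>x. t_eval l x + of_int (l m))"
    by (intro continuous_intros continuous_t_eval l) simp
  then show "continuous_map t_top euclidean (\<lambda>x. t_eval l (x \<otimes>\<^bsub>t_group\<^esub> in_t m))"
    by (rule continuous_map_eq) (simp add: t_eval_mult t_eval_in_t l)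
qed simp

lemma cscale_hom: "(\<lambda>r. z * of_real r) \<in> hom additive_group additive_group" for z :: complex
  by (intro homI) (auto simp: distrib_left)

lemma cscale_closed: "x \<in> carrier t_group \<Longrightarrow> cscale z x \<in> carrier tC_group"
  unfolding cscale_def t_group_def tC_group_def by (rule tensor_map_closed [OF _ _ cscale_hom]) auto

lemma eval_cscale:
  "l \<in> dual_lattice \<Longrightarrow> x \<in> carrier t_group \<Longrightarrow>
     tensor_eval additive_group l (cscale z x) = z * of_real (t_eval l x)"
  unfolding cscale_def t_group_def by (subst tensor_eval_map [OF _ _ cscale_hom]) auto

lemma exp_TC_closed: "x \<in> carrier tC_group \<Longrightarrow> exp_TC x \<in> carrier TC_group"
  unfolding exp_TC_def tC_group_def TC_group_def by (rule tensor_map_closed [OF _ _ e2pii_hom]) auto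

lemma TC_eval_exp_TC:
  "l \<in> dual_lattice \<Longrightarrow> x \<in> carrier tC_group \<Longrightarrow> TC_eval l (exp_TC x) = e2pii (tensor_eval additive_group l x)"
  unfolding exp_TC_def tC_group_def by (subst tensor_eval_map [OF _ _ e2pii_hom]) auto

lemma q_pow_closed [simp]: "x \<in> carrier t_group \<Longrightarrow> q_pow \<tau> x \<in> carrier TC_group"
  by (simp add: q_pow_def exp_TC_closed cscale_closed)

lemma TC_eval_q_pow:
  "l \<in> dual_lattice \<Longrightarrow> x \<in> carrier t_group \<Longrightarrow> TC_eval l (q_pow \<tau> x) = e2pii (\<tau> * of_real (t_eval l x))"
  by (simp add: q_pow_def TC_eval_exp_TC cscale_closed eval_cscale)

text \<open>The inclusion of the compact torus into the complex one. It has to be explicit: the two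
  share a type, but their elements are cosets in free groups over different coefficient
  sets.\<close>

definition T_incl :: "('l::ab_group_add, complex) tensor \<Rightarrow> ('l, complex) tensor" where
  "T_incl = tensor_map Cstar_group (\<lambda>z. z)"

lemma T_incl_hom: "(\<lambda>z. z) \<in> hom circle_group Cstar_group"
  by (intro homI) auto

lemma T_incl_closed [simp]: "s \<in> carrier T_group \<Longrightarrow> T_incl s \<in> carrier TC_group"
  unfolding T_incl_def T_group_def TC_group_def by (rule tensor_map_closed [OF _ _ T_incl_hom]) auto

lemma TC_eval_T_incl: "l \<in> dual_lattice \<Longrightarrow> s \<in> carrier T_group \<Longrightarrow> TC_eval l (T_incl s) = T_eval l s"
  unfolding T_incl_def T_group_def by (subst tensor_eval_map [OF _ _ T_incl_hom]) auto

text \<open>Since the modulus of \<open>q\<close> is not \<open>1\<close>, every element of \<open>T\<^sub>\<complex>\<close> is \<open>q\<^sup>x s\<close> for unique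
  \<open>x \<in> \<tt>\<close> and \<open>s \<in> T\<close>; \<open>q_log\<close> and \<open>q_phase\<close> are the two coordinates for rank one.\<close>

definition polar :: "complex \<Rightarrow> ('l::ab_group_add, real) tensor \<times> ('l, complex) tensor \<Rightarrow> ('l, complex) tensor" where
  "polar \<tau> = (\<lambda>(x, s). q_pow \<tau> x \<otimes>\<^bsub>TC_group\<^esub> T_incl s)"

definition q_log :: "complex \<Rightarrow> complex \<Rightarrow> real" where
  "q_log \<tau> z = - ln (norm z) / (2 * pi * Im \<tau>)"

definition q_phase :: "complex \<Rightarrow> complex \<Rightarrow> complex" where
  "q_phase \<tau> z = z * e2pii (- (\<tau> * of_real (q_log \<tau> z)))"

lemma polar_closed: "x \<in> carrier t_group \<Longrightarrow> s \<in> carrier T_group \<Longrightarrow> polar \<tau> (x, s) \<in> carrier TC_group"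
  by (simp add: polar_def)

lemma TC_eval_polar:
  "l \<in> dual_lattice \<Longrightarrow> x \<in> carrier t_group \<Longrightarrow> s \<in> carrier T_group \<Longrightarrow>
     TC_eval l (polar \<tau> (x, s)) = e2pii (\<tau> * of_real (t_eval l x)) * T_eval l s"
  by (simp add: polar_def TC_eval_mult TC_eval_q_pow TC_eval_T_incl)

lemma q_log_hom: "q_log \<tau> \<in> hom Cstar_group additive_group"
  by (intro homI) (auto simp: q_log_def norm_mult ln_mult add_divide_distrib diff_divide_distrib)

lemma norm_q_phase:
  assumes "Im \<tau> > 0" "z \<noteq> 0"
  shows "norm (q_phase \<tau> z) = 1"
  using assms by (simp add: q_phase_def norm_mult norm_e2pii q_log_def exp_minus)

text \<open>Multiplicativity of the phase, like that of \<open>q_log\<close>, allows the polar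
  coordinates of a single nonzero complex number to be applied to a whole tensor through
  \<open>tensor_map\<close>.\<close>

lemma q_phase_hom:
  assumes "Im \<tau> > 0"
  shows "q_phase \<tau> \<in> hom Cstar_group circle_group"
proof (intro homI)
  fix z w assume zw: "z \<in> carrier Cstar_group" "w \<in> carrier Cstar_group"
  have "q_log \<tau> (z * w) = q_log \<tau> z + q_log \<tau> w"
    using hom_mult [OF q_log_hom zw] by simp
  then have "e2pii (- (\<tau> * of_real (q_log \<tau> (z * w)))) =
      e2pii (- (\<tau> * of_real (q_log \<tau> z))) * e2pii (- (\<tau> * of_real (q_log \<tau> w)))"
    by (simp add: algebra_simps flip: e2pii_add)
  then show "q_phase \<tau> (z \<otimes>\<^bsub>Cstar_group\<^esub> w) = q_phase \<tau> z \<otimes>\<^bsub>circle_group\<^esub> q_phase \<tau> w"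
    by (simp add: q_phase_def)
qed (use assms norm_q_phase in auto)

text \<open>The factor \<open>u\<close> does not affect the modulus, which is exp (- 2 pi a Im
  \<tau>). Its logarithm recovers \<open>a\<close> because Im \<tau> is nonzero.\<close>

lemma q_log_polar:
  assumes "Im \<tau> > 0" "norm u = 1"
  shows "q_log \<tau> (e2pii (\<tau> * of_real a) * u) = a"
  using assms by (simp add: q_log_def norm_mult norm_e2pii)

context lattice_basis
begin

text \<open>The inverse applies \<open>q_log\<close> and \<open>q_phase\<close> to the coefficients.
  By naturality of evaluation, both the continuity claims and the inverse laws reduce to statements
  about single complex numbers.\<close>

lemma homeomorphic_polar:
  assumes \<tau>: "Im \<tau> > 0"
  shows "homeomorphic_map (prod_topology t_top T_top) TC_top (polar \<tau> :: ('l, real) tensor \<times> _ \<Rightarrow> _)"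
proof -
  let ?X = "prod_topology t_top T_top :: (('l, real) tensor \<times> ('l, complex) tensor) topology"
  let ?x = "tensor_map additive_group (q_log \<tau>) :: ('l, complex) tensor \<Rightarrow> ('l, real) tensor"
  let ?s = "tensor_map circle_group (q_phase \<tau>) :: ('l, complex) tensor \<Rightarrow> ('l, complex) tensor"
  have closed: "?x h \<in> carrier t_group" "?s h \<in> carrier T_group" if "h \<in> carrier TC_group" for h
    using that tensor_map_closed [OF _ _ q_log_hom] tensor_map_closed [OF _ _ q_phase_hom [OF \<tau>]]
    by (auto simp: t_group_def T_group_def TC_group_def)
  have eval_x: "t_eval l (?x h) = q_log \<tau> (TC_eval l h)"
    and eval_s: "T_eval l (?s h) = q_phase \<tau> (TC_eval l h)"
    if "l \<in> dual_lattice" "h \<in> carrier TC_group" for l h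
    using that tensor_eval_map [OF _ _ q_log_hom] tensor_eval_map [OF _ _ q_phase_hom [OF \<tau>]]
    by (auto simp: TC_group_def)
  have cont_log: "continuous_on (- {0}) (q_log \<tau>)"
    unfolding q_log_def divide_inverse by (intro continuous_intros) auto
  have cont_phase: "continuous_on (- {0}) (q_phase \<tau>)"
    unfolding q_phase_def
    by (intro continuous_on_mult continuous_on_id continuous_on_compose2 [OF continuous_on_e2pii]
        continuous_on_minus continuous_on_const continuous_on_of_real cont_log) auto
  have "continuous_map ?X TC_top (polar \<tau>)"
  proof (rule continuous_map_into_TC)
    fix l :: "'l \<Rightarrow> int" assume l: "l \<in> dual_lattice"
    have "continuous_map ?X euclidean (\<lambda>v. t_eval l (fst v))"
      using continuous_map_compose [OF continuous_map_fst continuous_t_eval [OF l]] by (simp add: comp_def)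
    then have "continuous_map ?X euclidean (\<lambda>v. e2pii (\<tau> * of_real (t_eval l (fst v))))"
      by (rule continuous_map_comp_on [where A = UNIV and h = "\<lambda>r. e2pii (\<tau> * of_real r)"])
        (auto intro!: continuous_on_compose2 [OF continuous_on_e2pii] continuous_intros)
    moreover have "continuous_map ?X euclidean (\<lambda>v. T_eval l (snd v))"
      using continuous_map_compose [OF continuous_map_snd continuous_T_eval [OF l]] by (simp add: comp_def)
    ultimately have "continuous_map ?X euclidean (\<lambda>v. e2pii (\<tau> * of_real (t_eval l (fst v))) * T_eval l (snd v))"
      by (rule continuous_map_mult)
    then show "continuous_map ?X euclidean (\<lambda>v. TC_eval l (polar \<tau> v))"
      by (rule continuous_map_eq) (auto simp: TC_eval_polar l)
  qed (auto simp: polar_closed)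
  moreover have "continuous_map TC_top ?X (\<lambda>h. (?x h, ?s h))"
  proof (rule continuous_map_pairedI)
    show "continuous_map TC_top t_top ?x"
    proof (rule continuous_map_into_t)
      fix l :: "'l \<Rightarrow> int" assume l: "l \<in> dual_lattice"
      have "continuous_map TC_top euclidean (\<lambda>h. q_log \<tau> (TC_eval l h))"
        by (rule continuous_map_comp_on [OF continuous_TC_eval [OF l] _ cont_log]) (simp add: TC_eval_nonzero l)
      then show "continuous_map TC_top euclidean (\<lambda>h. t_eval l (?x h))"
        by (rule continuous_map_eq) (simp add: eval_x l)
    qed (simp add: closed)
    show "continuous_map TC_top T_top ?s"
    proof (rule continuous_map_into_T)
      fix l :: "'l \<Rightarrow> int" assume l: "l \<in> dual_lattice"
      have "continuous_map TC_top euclidean (\<lambda>h. q_phase \<tau> (TC_eval l h))"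
        by (rule continuous_map_comp_on [OF continuous_TC_eval [OF l] _ cont_phase]) (simp add: TC_eval_nonzero l)
      then show "continuous_map TC_top euclidean (\<lambda>h. T_eval l (?s h))"
        by (rule continuous_map_eq) (simp add: eval_s l)
    qed (simp add: closed)
  qed
  moreover have "?x (polar \<tau> (x, s)) = x" if "x \<in> carrier t_group" "s \<in> carrier T_group" for x s
    using that \<tau>
    by (intro t_eqI closed polar_closed)
      (auto simp: eval_x polar_closed c_dual TC_eval_polar q_log_polar norm_T_eval)
  moreover have "?s (polar \<tau> (x, s)) = s" if "x \<in> carrier t_group" "s \<in> carrier T_group" for x s
  proof (intro T_eqI closed polar_closed that)
    fix i assume i: "i \<in> S"
    then show "T_eval (c i) (?s (polar \<tau> (x, s))) = T_eval (c i) s"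
      using that \<tau> e2pii_add [of "\<tau> * of_real (t_eval (c i) x)" "- (\<tau> * of_real (t_eval (c i) x))"]
      by (simp add: eval_s polar_closed c_dual TC_eval_polar q_log_polar norm_T_eval q_phase_def)
  qed
  moreover have "polar \<tau> (?x h, ?s h) = h" if "h \<in> carrier TC_group" for h
    using that
    by (intro TC_eqI polar_closed closed)
      (auto simp: TC_eval_polar closed c_dual eval_x eval_s q_phase_def simp flip: e2pii_add)
  ultimately have "homeomorphic_maps ?X TC_top (polar \<tau>) (\<lambda>h. (?x h, ?s h))"
    by (auto simp: homeomorphic_maps_def)
  then show ?thesis
    using homeomorphic_maps_map by blast
qed

end

subsection \<open>The isomorphism\<close>

text \<open>The right side does not mention \<open>y\<close>: the factor in \<open>LI_rel\<close> is
  independent of the chosen logarithm of \<open>s\<close>, being the value at \<open>s\<close> of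
  the character given by \<open>I m\<close>.\<close>

lemma LI_multiplier:
  assumes "I m \<in> dual_lattice" "y \<in> carrier t_group" "exp_T y = s"
  shows "e2pii (of_real (t_eval (I m) y)) = T_eval (I m) s"
  using assms T_eval_exp_T by metis

locale lattice_form = lattice_basis S e c
  for S :: "nat set" and e :: "nat \<Rightarrow> 'l::ab_group_add" and c :: "nat \<Rightarrow> 'l \<Rightarrow> int" +
  fixes I :: "'l \<Rightarrow> 'l \<Rightarrow> int"
  assumes form: "even_symmetric_form I"
begin

section \<open>The form and its bilinear extension\<close>

lemma I_dual [simp]: "I m \<in> dual_lattice"
  and I_sym: "I m n = I n m"
  using form by (auto simp: even_symmetric_form_def)

lemma I_add_right: "I m (n + k) = I m n + I m k"
  using I_dual dual_lattice_iff by blast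

lemma I_add_left: "I (m + n) = (\<lambda>k. I m k + I n k)"
  using I_add_right I_sym by metis

lemma I_zero_left: "I 0 = (\<lambda>k. 0)"
  using I_add_left [of 0 0] by (simp add: fun_eq_iff)

lemma I_minus_left: "I (- m) = (\<lambda>k. - I m k)"
proof
  fix k
  have "I (- m) k + I m k = 0"
    using I_add_left [of "- m" m] I_zero_left by (metis ab_left_minus)
  then show "I (- m) k = - I m k" by simp
qed

lemma neg_I_dual [simp]: "(\<lambda>k. - I m k) \<in> dual_lattice"
  using I_dual [of "- m"] by (simp only: I_minus_left)

lemma t_eval_I_add: "y \<in> carrier t_group \<Longrightarrow> t_eval (I (m + n)) y = t_eval (I m) y + t_eval (I n) y"
  using tensor_eval_add [of additive_group "I m" "I n" y] by (simp add: I_add_left t_group_def)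

text \<open>The inner lift in \<open>form_ext\<close> is evaluation at the functional
  \<open>I m\<close>, with the factors in the other order.\<close>

lemma form_ext_eq:
  "form_ext I x y = tensor_lift additive_group (\<lambda>m a. a * t_eval (I m) y) x"
proof -
  have "tensor_lift additive_group (\<lambda>n b. b * of_int (I m n)) y = t_eval (I m) y" for m
    by (simp add: tensor_eval_def additive_int_pow mult.commute)
  then show ?thesis by (simp add: form_ext_def)
qed

lemma biadditive_form:
  assumes "y \<in> carrier t_group"
  shows "biadditive additive_group additive_group (\<lambda>m a. a * t_eval (I m) y)"
  using assms unfolding biadditive_def
  by (auto simp: t_eval_I_add algebra_simps intro!: homI)

lemma form_ext_hom:
  assumes "y \<in> carrier t_group"
  shows "(\<lambda>x. form_ext I x y) \<in> hom t_group additive_group"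
  using tensor_lift_hom [OF _ _ biadditive_form [OF assms]] by (simp add: form_ext_eq t_group_def)

lemma form_ext_pure:
  assumes "y \<in> carrier t_group"
  shows "form_ext I (pure_tensor additive_group m a) y = a * t_eval (I m) y"
  using tensor_lift_pure [OF _ _ biadditive_form [OF assms], of a m] by (simp add: form_ext_eq)

lemma form_ext_in_t: "y \<in> carrier t_group \<Longrightarrow> form_ext I (in_t m) y = t_eval (I m) y"
  by (simp add: in_t_def form_ext_pure)

text \<open>Symmetry of the form enters here: on a pure tensor of \<open>n\<close> and
  \<open>a\<close>, one side gives \<open>I n m\<close> and the other \<open>I m n\<close>, both
  multiplied by \<open>a\<close>.\<close>

lemma form_ext_in_t_right:
  assumes "x \<in> carrier t_group"
  shows "form_ext I x (in_t m) = t_eval (I m) x"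
proof (rule hom_tensor_eqI [of "additive_group :: real monoid" "additive_group :: real monoid"])
  show "(\<lambda>x. form_ext I x (in_t m)) \<in> hom (tensor_group additive_group) additive_group"
    using form_ext_hom [OF in_t_closed] by (simp add: t_group_def)
  show "t_eval (I m) \<in> hom (tensor_group additive_group) additive_group"
    by (simp add: tensor_eval_hom)
  show "form_ext I (pure_tensor additive_group n a) (in_t m) = t_eval (I m) (pure_tensor additive_group n a)" for n a
    by (simp add: form_ext_pure t_eval_in_t tensor_eval_pure additive_int_pow I_sym)
qed (use assms in \<open>simp_all add: t_group_def\<close>)

text \<open>An explicit polynomial in coordinates, from which additivity in the second argument and
  continuity of the quadratic form are read off.\<close>

lemma form_ext_coords:
  assumes x: "x \<in> carrier t_group" and y: "y \<in> carrier t_group"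
  shows "form_ext I x y = (\<Sum>i\<in>S. t_eval (c i) x * t_eval (I (e i)) y)"
proof -
  have "form_ext I x y = form_ext I (finprod t_group (\<lambda>i. pure_tensor additive_group (e i) (t_eval (c i) x)) S) y"
    using tensor_expand [of additive_group x] x by (simp add: t_group_def)
  also have "\<dots> = (\<Sum>i\<in>S. form_ext I (pure_tensor additive_group (e i) (t_eval (c i) x)) y)"
    by (intro hom_finprod_additive [OF form_ext_hom [OF y]] finite_S)
      (auto simp: t_group_def comm_group_tensor_group intro!: pure_tensor_closed)
  finally show ?thesis by (simp add: form_ext_pure y)
qed

text \<open>The coefficient 2 arises because the two cross terms agree by symmetry.\<close>

lemma form_ext_translate:
  assumes x: "x \<in> carrier t_group"
  shows "form_ext I (x \<otimes>\<^bsub>t_group\<^esub> in_t m) (x \<otimes>\<^bsub>t_group\<^esub> in_t m) =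
    form_ext I x x + 2 * t_eval (I m) x + of_int (I m m)"
proof -
  have "form_ext I x (x \<otimes>\<^bsub>t_group\<^esub> in_t m) = form_ext I x x + form_ext I x (in_t m)"
    using x by (simp add: form_ext_coords t_eval_mult distrib_left sum.distrib)
  moreover have "form_ext I (x \<otimes>\<^bsub>t_group\<^esub> in_t m) (x \<otimes>\<^bsub>t_group\<^esub> in_t m) =
      form_ext I x (x \<otimes>\<^bsub>t_group\<^esub> in_t m) + form_ext I (in_t m) (x \<otimes>\<^bsub>t_group\<^esub> in_t m)"
    using x hom_mult [OF form_ext_hom [of "x \<otimes>\<^bsub>t_group\<^esub> in_t m"], of x "in_t m"] by simp
  ultimately show ?thesis
    using x by (simp add: form_ext_in_t form_ext_in_t_right t_eval_mult t_eval_in_t)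
qed

lemma continuous_form_ext: "continuous_map t_top euclidean (\<lambda>x. form_ext I x x)"
proof -
  have "continuous_map t_top euclidean (\<lambda>x. \<Sum>i\<in>S. t_eval (c i) x * t_eval (I (e i)) x)"
    by (intro continuous_intros continuous_map_mult finite_S continuous_t_eval I_dual c_dual)
  then show ?thesis
    by (rule continuous_map_eq) (simp add: form_ext_coords)
qed

text \<open>The lattice action on the trivial bundle whose orbits are the classes of
  \<open>LI_rel\<close>. \<open>LI_rel\<close> is written downwards, from x + m to x; here the step
  goes upwards, which is the source of the minus sign and matches the direction of
  \<open>Lo_rel\<close>.\<close>

definition shift :: "'l \<Rightarrow> (('l, real) tensor \<times> ('l, complex) tensor) \<times> complex \<Rightarrow>
    (('l, real) tensor \<times> ('l, complex) tensor) \<times> complex" where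
  "shift m = (\<lambda>((x, s), z). ((x \<otimes>\<^bsub>t_group\<^esub> in_t m, s), z * T_eval (\<lambda>k. - I m k) s))"

lemma T_eval_neg_I_add:
  assumes "s \<in> carrier T_group"
  shows "T_eval (\<lambda>k. - I (m + n) k) s = T_eval (\<lambda>k. - I m k) s * T_eval (\<lambda>k. - I n k) s"
  using tensor_eval_add [of circle_group "\<lambda>k. - I m k" "\<lambda>k. - I n k" s] assms
  by (simp add: I_add_left T_group_def)

lemma T_eval_neg_I_0:
  assumes "s \<in> carrier T_group"
  shows "T_eval (\<lambda>k. - I 0 k) s = 1"
  using tensor_eval_0 [of circle_group s] assms by (simp add: I_zero_left T_group_def)

lemma in_t_0: "in_t (0 :: 'l) = \<one>\<^bsub>t_group\<^esub>"
proof -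
  interpret t: comm_group "t_group :: ('l, real) tensor monoid" by simp
  have "in_t (0 :: 'l) \<otimes>\<^bsub>t_group\<^esub> in_t 0 = in_t 0"
    using in_t_add [of 0 "0 :: 'l"] by simp
  then show ?thesis by simp
qed

lemma shift_0:
  assumes "x \<in> carrier t_group" "s \<in> carrier T_group"
  shows "shift 0 ((x, s), z) = ((x, s), z)"
proof -
  interpret t: comm_group "t_group :: ('l, real) tensor monoid" by simp
  show ?thesis using assms by (simp add: shift_def in_t_0 T_eval_neg_I_0)
qed

text \<open>The factor depends only on \<open>s\<close>, which the translation leaves alone, so
  successive factors simply multiply.\<close>

lemma shift_shift:
  assumes "x \<in> carrier t_group" "s \<in> carrier T_group"
  shows "shift n (shift m ((x, s), z)) = shift (m + n) ((x, s), z)"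
proof -
  interpret t: comm_group "t_group :: ('l, real) tensor monoid" by simp
  show ?thesis using assms by (simp add: shift_def in_t_add T_eval_neg_I_add t.m_assoc)
qed

lemma translate_back:
  fixes x :: "('l, real) tensor"
  assumes "x \<in> carrier t_group"
  shows "x \<otimes>\<^bsub>t_group\<^esub> in_t m \<otimes>\<^bsub>t_group\<^esub> in_t (- m) = x"
proof -
  interpret t: comm_group "t_group :: ('l, real) tensor monoid" by simp
  show ?thesis
    using assms by (simp add: t.m_assoc flip: in_t_add) (simp add: in_t_0)
qed

text \<open>Exhibits \<open>LI_rel\<close> as the orbit relation of \<open>shift\<close>. A step of
  \<open>LI_rel\<close> with parameter \<open>m\<close> is the shift by \<open>- m\<close>, so each
  direction of the proof changes the sign of \<open>m\<close>.\<close>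

lemma LI_rel_iff:
  "(v, w) \<in> LI_rel I \<longleftrightarrow> (\<exists>x s z m. x \<in> carrier t_group \<and> s \<in> carrier T_group \<and> v = ((x, s), z) \<and> w = shift m v)"
proof
  assume "(v, w) \<in> LI_rel I"
  then obtain x m s y z where *: "v = ((x \<otimes>\<^bsub>t_group\<^esub> in_t m, s), z)"
      "w = ((x, s), z * e2pii (of_real (form_ext I (in_t m) y)))"
      "x \<in> carrier t_group" "s \<in> carrier T_group" "y \<in> carrier t_group" "exp_T y = s"
    unfolding LI_rel_def by blast
  have "e2pii (of_real (form_ext I (in_t m) y)) = T_eval (\<lambda>k. - I (- m) k) s"
    using * LI_multiplier [of I m y s] by (simp add: form_ext_in_t I_minus_left)
  moreover have "x \<otimes>\<^bsub>t_group\<^esub> in_t m \<otimes>\<^bsub>t_group\<^esub> in_t (- m) = x"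
    using *(3) by (rule translate_back)
  ultimately have "w = shift (- m) v"
    using * by (simp add: shift_def)
  then show "\<exists>x s z m. x \<in> carrier t_group \<and> s \<in> carrier T_group \<and> v = ((x, s), z) \<and> w = shift m v"
    using * by (metis t_mult_closed in_t_closed)
next
  assume "\<exists>x s z m. x \<in> carrier t_group \<and> s \<in> carrier T_group \<and> v = ((x, s), z) \<and> w = shift m v"
  then obtain x s z m where *: "x \<in> carrier t_group" "s \<in> carrier T_group" "v = ((x, s), z)" "w = shift m v"
    by blast
  \<comment> \<open>\<open>LI_rel\<close> asks for a logarithm of \<open>s\<close>, and surjectivity
    of the exponential supplies one.\<close>
  obtain y where y: "y \<in> carrier t_group" "exp_T y = s"
    using exp_T_surj [OF *(2)] .
  define x' where "x' = x \<otimes>\<^bsub>t_group\<^esub> in_t m"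
  have "x' \<otimes>\<^bsub>t_group\<^esub> in_t (- m) = x"
    using translate_back [OF *(1)] by (simp add: x'_def)
  moreover have "e2pii (of_real (form_ext I (in_t (- m)) y)) = T_eval (\<lambda>k. - I m k) s"
    using y LI_multiplier [of I "- m" y s] by (simp add: form_ext_in_t I_minus_left)
  ultimately have "v = ((x' \<otimes>\<^bsub>t_group\<^esub> in_t (- m), s), z)"
      "w = ((x', s), z * e2pii (of_real (form_ext I (in_t (- m)) y)))"
    using * by (simp_all add: shift_def x'_def)
  moreover have "x' \<in> carrier t_group" using * by (simp add: x'_def)
  ultimately show "(v, w) \<in> LI_rel I"
    unfolding LI_rel_def using *(2) y by blast
qed

text \<open>The lattice acts freely on the base points, so a shift that fixes \<open>(x, s)\<close>
  is the shift by 0.\<close>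

lemma shift_inj:
  assumes "x \<in> carrier t_group" "s \<in> carrier T_group" "shift m ((x, s), z) = ((x, s), w)"
  shows "z = w"
proof -
  interpret t: comm_group "t_group :: ('l, real) tensor monoid" by simp
  have "x \<otimes>\<^bsub>t_group\<^esub> in_t m = x"
    using assms by (simp add: shift_def)
  then have "in_t m = in_t (0 :: 'l)"
    using assms(1) by (simp add: in_t_0)
  then have "m = 0" by (rule in_t_inj)
  then show ?thesis using assms shift_0 by simp
qed

definition torus_proj :: "('l, real) tensor \<times> ('l, complex) tensor \<Rightarrow> ('l, complex) tensor \<times> ('l, complex) tensor" where
  "torus_proj = (\<lambda>(x, s). (exp_T x, s))"

lemma torus_proj_eq_iff:
  assumes "x \<in> carrier t_group" "x' \<in> carrier t_group"
  shows "torus_proj (x, s) = torus_proj (x', s') \<longleftrightarrow> s' = s \<and> (\<exists>m. x' = x \<otimes>\<^bsub>t_group\<^esub> in_t m)"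
  using exp_T_eq_iff [OF assms(2,1)] by (auto simp: torus_proj_def)

lemma continuous_shift:
  "continuous_map (prod_topology (prod_topology t_top T_top) euclidean)
     (prod_topology (prod_topology t_top T_top) euclidean) (shift m)"
proof -
  let ?Q = "prod_topology (prod_topology t_top T_top) euclidean ::
    ((('l, real) tensor \<times> ('l, complex) tensor) \<times> complex) topology"
  have x: "continuous_map ?Q t_top (\<lambda>v. fst (fst v))" and s: "continuous_map ?Q T_top (\<lambda>v. snd (fst v))"
    using continuous_map_compose [OF continuous_map_fst continuous_map_fst]
      continuous_map_compose [OF continuous_map_fst continuous_map_snd] by (auto simp: comp_def)
  have "continuous_map ?Q ?Q (\<lambda>v. ((fst (fst v) \<otimes>\<^bsub>t_group\<^esub> in_t m, snd (fst v)),
      snd v * T_eval (\<lambda>k. - I m k) (snd (fst v))))"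
    using continuous_map_compose [OF x continuous_translate_t [of m]] s
      continuous_map_compose [OF s continuous_T_eval [OF neg_I_dual [of m]]]
    by (intro continuous_map_pairedI continuous_map_mult continuous_map_snd) (auto simp: comp_def)
  then show ?thesis
    by (simp add: shift_def case_prod_unfold)
qed

text \<open>The substance lies in three facts: the fibres of \<open>torus_proj\<close> are the
  lattice orbits, the action is free, and the exponential is open and locally injective. Linearity
  is visible from the multiplier.\<close>

lemma fibrewise_linear_LI_rel:
  "fibrewise_linear_rel (prod_topology t_top T_top) (LI_rel I) (prod_topology T_top T_top) torus_proj"
proof
  let ?X = "prod_topology t_top T_top :: (('l, real) tensor \<times> ('l, complex) tensor) topology"
  let ?Q = "prod_topology ?X euclidean :: ((('l, real) tensor \<times> ('l, complex) tensor) \<times> complex) topology"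
  let ?B = "prod_topology T_top T_top :: (('l, complex) tensor \<times> ('l, complex) tensor) topology"
  have sym: "sym (LI_rel I)"
  proof (rule symI)
    fix v w assume "(v, w) \<in> LI_rel I"
    then obtain x s z m where *: "x \<in> carrier t_group" "s \<in> carrier T_group" "v = ((x, s), z)" "w = shift m v"
      unfolding LI_rel_iff by blast
    have "v = shift (- m) w"
      using * by (simp add: shift_shift shift_0)
    moreover have "w = ((x \<otimes>\<^bsub>t_group\<^esub> in_t m, s), z * T_eval (\<lambda>k. - I m k) s)"
      using * by (simp add: shift_def)
    moreover have "x \<otimes>\<^bsub>t_group\<^esub> in_t m \<in> carrier t_group"
      using * by simp
    ultimately show "(w, v) \<in> LI_rel I"
      unfolding LI_rel_iff using *(2) by blast
  qed
  show "equiv (topspace ?X \<times> UNIV) (LI_rel I)"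
  proof (rule equivI)
    show "LI_rel I \<subseteq> (topspace ?X \<times> UNIV) \<times> (topspace ?X \<times> UNIV)"
      by (auto simp: LI_rel_iff shift_def)
    show "refl_on (topspace ?X \<times> UNIV) (LI_rel I)"
    proof (rule refl_onI)
      fix v assume "v \<in> topspace ?X \<times> (UNIV :: complex set)"
      then obtain x s z where "v = ((x, s), z)" "x \<in> carrier t_group" "s \<in> carrier T_group" by auto
      then show "(v, v) \<in> LI_rel I"
        unfolding LI_rel_iff using shift_0 by metis
    qed
    show "trans (LI_rel I)"
    proof (rule transI)
      fix u v w assume "(u, v) \<in> LI_rel I" "(v, w) \<in> LI_rel I"
      then show "(u, w) \<in> LI_rel I"
        unfolding LI_rel_iff using shift_shift by metis
    qed
  qed (rule sym)
  have cases: thesis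
    if "((v, z), (w, c)) \<in> LI_rel I"
      "\<And>x s m. x \<in> carrier t_group \<Longrightarrow> s \<in> carrier T_group \<Longrightarrow> v = (x, s) \<Longrightarrow>
         w = (x \<otimes>\<^bsub>t_group\<^esub> in_t m, s) \<Longrightarrow> c = z * T_eval (\<lambda>k. - I m k) s \<Longrightarrow> thesis" for v z w c thesis
    using that by (auto simp: LI_rel_iff shift_def)
  have intro: "(((x, s), z), ((x \<otimes>\<^bsub>t_group\<^esub> in_t m, s), z * T_eval (\<lambda>k. - I m k) s)) \<in> LI_rel I"
    if "x \<in> carrier t_group" "s \<in> carrier T_group" for x s z m
    using that unfolding LI_rel_iff by (auto simp: shift_def)
  show "torus_proj v = torus_proj w" if "((v, z), (w, c)) \<in> LI_rel I" for v z w c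
    using that by (rule cases) (auto simp: torus_proj_eq_iff)
  show "((v, a * z), (w, a * c)) \<in> LI_rel I" if "((v, z), (w, c)) \<in> LI_rel I" for v z w c a
    using that
  proof (rule cases)
    fix x s m assume "x \<in> carrier t_group" "s \<in> carrier T_group" "v = (x, s)"
      "w = (x \<otimes>\<^bsub>t_group\<^esub> in_t m, s)" "c = z * T_eval (\<lambda>k. - I m k) s"
    then show ?thesis using intro [of x s "a * z" m] by (simp add: mult.assoc)
  qed
  show "z = c" if R: "((v, z), (v, c)) \<in> LI_rel I" for v z c
  proof -
    obtain x s m where "x \<in> carrier t_group" "s \<in> carrier T_group" "v = (x, s)" "(v, c) = shift m (v, z)"
      using R unfolding LI_rel_iff by blast
    then show ?thesis using shift_inj [of x s m z c] by simp
  qed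
  show "((v, z + z'), (w, c + c')) \<in> LI_rel I"
    if 1: "((v, z), (w, c)) \<in> LI_rel I" and 2: "((v, z'), (w, c')) \<in> LI_rel I" for v z w c z' c'
  proof (rule cases [OF 1])
    fix x s m assume *: "x \<in> carrier t_group" "s \<in> carrier T_group" "v = (x, s)"
      "w = (x \<otimes>\<^bsub>t_group\<^esub> in_t m, s)" "c = z * T_eval (\<lambda>k. - I m k) s"
    show ?thesis
    proof (rule cases [OF 2])
      fix x' s' m' assume **: "v = (x', s')" "w = (x' \<otimes>\<^bsub>t_group\<^esub> in_t m', s')" "c' = z' * T_eval (\<lambda>k. - I m' k) s'"
      interpret t: comm_group "t_group :: ('l, real) tensor monoid" by simp
      \<comment> \<open>The two related pairs join the same base points, so they use the same
        lattice vector and hence the same multiplier.\<close>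
      have "in_t m' = in_t m"
        using * ** by simp
      then have "m' = m" by (rule in_t_inj)
      then show ?thesis using * ** intro [of x s "z + z'" m] by (simp add: distrib_right)
    qed
  qed
  show "\<exists>c. ((v, z), (w, c)) \<in> LI_rel I"
    if v: "v \<in> topspace ?X" and w: "w \<in> topspace ?X" and eq: "torus_proj v = torus_proj w" for v w z
  proof -
    obtain x s x' s' where *: "v = (x, s)" "w = (x', s')" "x \<in> carrier t_group" "s \<in> carrier T_group" "x' \<in> carrier t_group"
      using v w by auto
    then obtain m where "s' = s" "x' = x \<otimes>\<^bsub>t_group\<^esub> in_t m"
      using eq torus_proj_eq_iff by metis
    then show ?thesis using * intro by blast
  qed
  show "openin ?Q (LI_rel I `` V)" if V: "openin ?Q V" for V
  proof -
    \<comment> \<open>By symmetry of the relation, the saturation is a union of preimages rather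
      than images, so continuity of each \<open>shift\<close> suffices.\<close>
    have "LI_rel I `` V = (\<Union>m. {w \<in> topspace ?Q. shift m w \<in> V})"
    proof (intro equalityI subsetI)
      fix w assume "w \<in> LI_rel I `` V"
      then obtain v where v: "v \<in> V" "(w, v) \<in> LI_rel I"
        using sym by (auto dest: symD)
      then show "w \<in> (\<Union>m. {w \<in> topspace ?Q. shift m w \<in> V})"
        unfolding LI_rel_iff by auto
    next
      fix w assume "w \<in> (\<Union>m. {w \<in> topspace ?Q. shift m w \<in> V})"
      then obtain m where m: "w \<in> topspace ?Q" "shift m w \<in> V" by blast
      then obtain x s z where "w = ((x, s), z)" "x \<in> carrier t_group" "s \<in> carrier T_group" by auto
      then have "(w, shift m w) \<in> LI_rel I" unfolding LI_rel_iff by blast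
      then show "w \<in> LI_rel I `` V" using m sym by (auto dest: symD)
    qed
    moreover have "openin ?Q {w \<in> topspace ?Q. shift m w \<in> V}" for m
      using continuous_shift V by (rule openin_continuous_map_preimage)
    ultimately show ?thesis by (auto intro: openin_Union)
  qed
  show "continuous_map ?X ?B torus_proj"
    using continuous_map_compose [OF continuous_map_fst continuous_exp_T]
    unfolding torus_proj_def case_prod_unfold
    by (intro continuous_map_pairedI continuous_map_snd) (simp add: comp_def)
  show "open_map ?X ?B torus_proj"
    using open_map_map_prod [OF open_map_exp_T open_map_id] by (simp add: torus_proj_def)
  show "\<exists>W. openin ?X W \<and> b \<in> torus_proj ` W \<and> inj_on torus_proj W" if "b \<in> topspace ?B" for b
  proof -
    obtain t s where b: "b = (t, s)" "t \<in> carrier T_group" "s \<in> carrier T_group"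
      using \<open>b \<in> topspace ?B\<close> by auto
    obtain x :: "('l, real) tensor" where x: "x \<in> carrier t_group" "exp_T x = t"
      using exp_T_surj [OF b(2)] .
    obtain W where W: "openin t_top W" "x \<in> W" "inj_on exp_T W"
      using exp_T_locally_inj [OF x(1)] by blast
    \<comment> \<open>Only the first factor is wrapped by \<open>torus_proj\<close>, so a small
      sheet there times the whole second torus will do.\<close>
    have "openin ?X (W \<times> topspace T_top)"
      using W openin_topspace [of T_top] unfolding openin_prod_Times_iff by blast
    moreover have "b \<in> torus_proj ` (W \<times> topspace T_top)"
      using W x b by (auto simp: torus_proj_def)
    moreover have "inj_on torus_proj (W \<times> topspace T_top)"
      using W(3) by (auto simp: inj_on_def torus_proj_def)
    ultimately show ?thesis by blast
  qed
qed

section \<open>Passage from the real description to the complex torus\<close>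

lemma polar_translate:
  fixes x :: "('l, real) tensor"
  assumes "x \<in> carrier t_group" "s \<in> carrier T_group"
  shows "polar \<tau> (x \<otimes>\<^bsub>t_group\<^esub> in_t m, s) = polar \<tau> (x, s) \<otimes>\<^bsub>TC_group\<^esub> q_pow \<tau> (in_t m)"
  using assms
  by (intro TC_eqI)
    (auto simp: polar_closed c_dual TC_eval_mult TC_eval_polar TC_eval_q_pow t_eval_mult distrib_left e2pii_add)

text \<open>Connects \<open>polar\<close> with the map (x, y) to \<tau> x + y that prescribes the
  identification of the base spaces.\<close>

lemma polar_exp_T:
  fixes x y :: "('l, real) tensor"
  assumes "x \<in> carrier t_group" "y \<in> carrier t_group"
  shows "polar \<tau> (x, exp_T y) = exp_TC (cscale \<tau> x \<otimes>\<^bsub>tC_group\<^esub> cscale 1 y)"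
proof -
  have closed: "cscale \<tau> x \<otimes>\<^bsub>tC_group\<^esub> cscale 1 y \<in> carrier tC_group"
    using assms by (simp add: comm_groupE(1) cscale_closed)
  have "tensor_eval additive_group l (cscale \<tau> x \<otimes>\<^bsub>tC_group\<^esub> cscale 1 y) =
      \<tau> * of_real (t_eval l x) + of_real (t_eval l y)" if "l \<in> dual_lattice" for l
    using assms that tensor_eval_mult [of additive_group l "cscale \<tau> x" "cscale 1 y"]
      cscale_closed [OF assms(1), of \<tau>] cscale_closed [OF assms(2), of 1]
    by (simp add: tC_group_def eval_cscale)
  then show ?thesis
    using assms closed
    by (intro TC_eqI)
      (auto simp: polar_closed exp_T_closed exp_TC_closed c_dual TC_eval_polar TC_eval_exp_TC T_eval_exp_T e2pii_add)
qed

context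
  fixes \<tau> :: complex
  assumes \<tau>: "Im \<tau> > 0"
begin

lemma polar_surj:
  assumes "h \<in> carrier TC_group"
  obtains x :: "('l, real) tensor" and s where "x \<in> carrier t_group" "s \<in> carrier T_group" "h = polar \<tau> (x, s)"
proof -
  have "h \<in> polar \<tau> ` topspace (prod_topology t_top T_top :: (('l, real) tensor \<times> ('l, complex) tensor) topology)"
    unfolding homeomorphic_imp_surjective_map [OF homeomorphic_polar [OF \<tau>]] using assms by simp
  then obtain v :: "('l, real) tensor \<times> ('l, complex) tensor" where
      "v \<in> carrier t_group \<times> carrier T_group" "h = polar \<tau> v"
    by auto
  then show thesis using that by (cases v) auto
qed

text \<open>\<open>polar\<close> turns translation by a lattice vector into multiplication by the
  corresponding power of q, and lattice translates are exactly the points with equal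
  \<open>torus_proj\<close>. This makes the base map both well defined and injective.\<close>

lemma q_rel_polar:
  assumes v: "v \<in> carrier t_group \<times> carrier T_group"
  shows "q_rel \<tau> `` {polar \<tau> v} =
    polar \<tau> ` {w \<in> carrier t_group \<times> carrier T_group. torus_proj v = torus_proj w}"
proof -
  obtain x s where xs: "v = (x, s)" "x \<in> carrier t_group" "s \<in> carrier T_group" using v by auto
  have "q_rel \<tau> `` {polar \<tau> v} = {polar \<tau> (x \<otimes>\<^bsub>t_group\<^esub> in_t m, s) | m. True}"
    using xs polar_closed by (auto simp: q_rel_def polar_translate)
  also have "\<dots> = polar \<tau> ` {(x \<otimes>\<^bsub>t_group\<^esub> in_t m, s) | m. True}"
    by blast
  also have "{(x \<otimes>\<^bsub>t_group\<^esub> in_t m, s) | m. True} =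
      {w \<in> carrier t_group \<times> carrier T_group. torus_proj v = torus_proj w}"
  proof (intro equalityI subsetI)
    fix w assume "w \<in> {(x \<otimes>\<^bsub>t_group\<^esub> in_t m, s) | m. True}"
    then show "w \<in> {w \<in> carrier t_group \<times> carrier T_group. torus_proj v = torus_proj w}"
      using xs by (auto simp: torus_proj_eq_iff)
  next
    fix w assume "w \<in> {w \<in> carrier t_group \<times> carrier T_group. torus_proj v = torus_proj w}"
    then obtain x' s' where "w = (x', s')" "x' \<in> carrier t_group" "torus_proj (x, s) = torus_proj (x', s')"
      using xs by auto
    then show "w \<in> {(x \<otimes>\<^bsub>t_group\<^esub> in_t m, s) | m. True}"
      using xs torus_proj_eq_iff by blast
  qed
  finally show ?thesis .
qed

text \<open>Uses an arbitrary lift of \<open>b\<close>; \<open>base_map_proj\<close> removes the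
  dependence on the choice.\<close>

definition base_map :: "('l, complex) tensor \<times> ('l, complex) tensor \<Rightarrow> ('l, complex) tensor set" where
  "base_map b = q_rel \<tau> `` {polar \<tau> (SOME v. v \<in> carrier t_group \<times> carrier T_group \<and> torus_proj v = b)}"

lemma base_map_proj:
  assumes v: "v \<in> carrier t_group \<times> carrier T_group"
  shows "base_map (torus_proj v) = q_rel \<tau> `` {polar \<tau> v}"
proof -
  let ?w = "SOME w. w \<in> carrier t_group \<times> carrier T_group \<and> torus_proj w = torus_proj v"
  have "?w \<in> carrier t_group \<times> carrier T_group \<and> torus_proj ?w = torus_proj v"
    using v by (intro someI [of "\<lambda>w. w \<in> carrier t_group \<times> carrier T_group \<and> torus_proj w = torus_proj v"]) simp
  then show ?thesis
    unfolding base_map_def using v by (simp add: q_rel_polar)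
qed

lemma induced_base_map: "induced_base_map \<tau> base_map"
  unfolding induced_base_map_def
proof (intro ballI)
  fix x y :: "('l, real) tensor"
  assume xy: "x \<in> carrier t_group" "y \<in> carrier t_group"
  have "base_map (torus_proj (x, exp_T y)) = q_rel \<tau> `` {polar \<tau> (x, exp_T y)}"
    using xy exp_T_closed by (intro base_map_proj) auto
  then show "base_map (exp_T x, exp_T y) = q_rel \<tau> `` {exp_TC (cscale \<tau> x \<otimes>\<^bsub>tC_group\<^esub> cscale 1 y)}"
    using xy by (simp add: polar_exp_T) (simp add: torus_proj_def)
qed

text \<open>Both base spaces are quotients of one space up to \<open>polar\<close>:
  \<open>torus_proj\<close> is a quotient map because it is continuous, open and onto, and by
  \<open>q_rel_polar\<close> the two quotients have the same fibres.\<close>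

lemma homeomorphic_base_map:
  "homeomorphic_map (prod_topology T_top T_top) (quotient_topology TC_top (q_rel \<tau>)) base_map"
proof (rule homeomorphic_map_between_quotients [OF _ quotient_map_class homeomorphic_polar [OF \<tau>]])
  interpret fibrewise_linear_rel "prod_topology t_top T_top :: (('l, real) tensor \<times> ('l, complex) tensor) topology"
      "LI_rel I" "prod_topology T_top T_top" torus_proj
    by (rule fibrewise_linear_LI_rel)
  let ?X = "prod_topology t_top T_top :: (('l, real) tensor \<times> ('l, complex) tensor) topology"
  have "torus_proj ` topspace ?X = topspace (prod_topology T_top T_top)"
  proof (intro equalityI subsetI)
    fix b assume "b \<in> torus_proj ` topspace ?X"
    then show "b \<in> topspace (prod_topology T_top T_top)"
      by (auto simp: torus_proj_def exp_T_closed)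
  next
    fix b :: "('l, complex) tensor \<times> ('l, complex) tensor"
    assume "b \<in> topspace (prod_topology T_top T_top)"
    then obtain W where "openin ?X W" "b \<in> torus_proj ` W"
      using p_local by blast
    then show "b \<in> torus_proj ` topspace ?X"
      using openin_subset by blast
  qed
  then show "quotient_map ?X (prod_topology T_top T_top) torus_proj"
    by (rule continuous_open_imp_quotient_map [OF p_cont p_open])
  show "base_map (torus_proj v) = q_rel \<tau> `` {polar \<tau> v}" if "v \<in> topspace ?X" for v
    using that by (intro base_map_proj) auto
  fix v w assume "v \<in> topspace ?X" "w \<in> topspace ?X"
  then have vw: "v \<in> carrier t_group \<times> carrier T_group" "w \<in> carrier t_group \<times> carrier T_group"
    by auto
  have inj: "inj_on (polar \<tau>) (carrier t_group \<times> carrier T_group :: (('l, real) tensor \<times> ('l, complex) tensor) set)"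
    using homeomorphic_imp_injective_map [OF homeomorphic_polar [OF \<tau>]] by simp
  show "torus_proj v = torus_proj w \<longleftrightarrow> q_rel \<tau> `` {polar \<tau> v} = q_rel \<tau> `` {polar \<tau> w}"
    unfolding q_rel_polar [OF vw(1)] q_rel_polar [OF vw(2)]
    using vw by (subst inj_on_image_eq_iff [OF inj]) auto
qed

definition multiplier :: "('l, real) tensor \<times> ('l, complex) tensor \<Rightarrow> complex" where
  "multiplier = (\<lambda>(x, s). q_powr \<tau> (- (1/2) * form_ext I x x))"

lemma continuous_multiplier: "continuous_map (prod_topology t_top T_top) euclidean multiplier"
proof -
  have "continuous_map (prod_topology t_top T_top :: (('l, real) tensor \<times> ('l, complex) tensor) topology)
      euclidean (\<lambda>v. form_ext I (fst v) (fst v))"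
    using continuous_map_compose [OF continuous_map_fst continuous_form_ext] by (simp add: comp_def)
  then show ?thesis
    unfolding multiplier_def case_prod_unfold q_powr_def
    by (rule continuous_map_comp_on [where A = UNIV and h = "\<lambda>r. e2pii (\<tau> * of_real (- (1/2) * r))"])
      (auto intro!: continuous_on_compose2 [OF continuous_on_e2pii] continuous_intros)
qed

text \<open>Completing the square: \<open>\<half>I(x + m, x + m) = \<half>I(x, x) + I(m, x) + \<half>I(m, m)\<close>, so the factor
  \<open>q\<close> to the power \<open>- \<half>I(x, x)\<close> trades the two automorphy factors for each other.\<close>

lemma multiplier_shift:
  assumes x: "x \<in> carrier t_group" and s: "s \<in> carrier T_group"
  shows "T_eval (\<lambda>k. - I m k) s * multiplier (x \<otimes>\<^bsub>t_group\<^esub> in_t m, s) =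
    multiplier (x, s) * TC_eval (\<lambda>k. - I m k) (polar \<tau> (x, s)) * q_powr \<tau> (- (1/2) * of_int (I m m))"
proof -
  \<comment> \<open>Brings the q-exponent of the character at \<open>polar \<tau> (x, s)\<close>
    into the shape of the cross term in \<open>form_ext_translate\<close>.\<close>
  have "t_eval (\<lambda>k. - I m k) x = - t_eval (I m) x"
  proof -
    have "t_eval (\<lambda>k. - I m k) x + t_eval (I m) x = t_eval (\<lambda>k. 0) x"
      using tensor_eval_add [of additive_group "\<lambda>k. - I m k" "I m" x] x by (simp add: t_group_def)
    also have "\<dots> = 0"
      using tensor_eval_0 [of additive_group x] x by (simp add: t_group_def)
    finally show ?thesis by simp
  qed
  then have "TC_eval (\<lambda>k. - I m k) (polar \<tau> (x, s)) = e2pii (- (\<tau> * of_real (t_eval (I m) x))) * T_eval (\<lambda>k. - I m k) s"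
    using x s by (simp add: TC_eval_polar)
  moreover have "multiplier (x \<otimes>\<^bsub>t_group\<^esub> in_t m, s) =
      multiplier (x, s) * e2pii (- (\<tau> * of_real (t_eval (I m) x))) * q_powr \<tau> (- (1/2) * of_int (I m m))"
    using x by (simp add: multiplier_def q_powr_def form_ext_translate algebra_simps add_divide_distrib flip: e2pii_add)
  ultimately show ?thesis by simp
qed

text \<open>Equality of the relations is what \<open>quotient_bundle_iso\<close> asks for: through
  it the Looijenga relation inherits its properties from \<open>LI_rel\<close>. One inclusion writes
  a point of the complex torus in polar form, the other reads \<open>multiplier_shift\<close>
  backwards.\<close>

lemma Lo_rel_eq:
  "Lo_rel \<tau> I =
     {((polar \<tau> v, z * multiplier v), (polar \<tau> w, c * multiplier w)) | v z w c. ((v, z), (w, c)) \<in> LI_rel I}"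
proof (intro equalityI subsetI)
  fix p assume "p \<in> Lo_rel \<tau> I"
  then obtain h a m where p: "h \<in> carrier TC_group"
      "p = ((h, a), (h \<otimes>\<^bsub>TC_group\<^esub> q_pow \<tau> (in_t m),
        a * TC_eval (\<lambda>k. - I m k) h * q_powr \<tau> (- (1/2) * of_int (I m m))))"
    unfolding Lo_rel_def by blast
  obtain x s where xs: "x \<in> carrier t_group" "s \<in> carrier T_group" "h = polar \<tau> (x, s)"
    using polar_surj [OF p(1)] .
  \<comment> \<open>The multiplier is an exponential and never vanishes, so every fibre value is
    attained after rescaling.\<close>
  define z where "z = a / multiplier (x, s)"
  have a: "a = z * multiplier (x, s)"
    by (simp add: z_def multiplier_def q_powr_def)
  have "p = ((polar \<tau> (x, s), z * multiplier (x, s)),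
      (polar \<tau> (x \<otimes>\<^bsub>t_group\<^esub> in_t m, s), z * T_eval (\<lambda>k. - I m k) s * multiplier (x \<otimes>\<^bsub>t_group\<^esub> in_t m, s)))"
    using xs multiplier_shift [OF xs(1,2), of m] by (simp add: p(2) a polar_translate mult.assoc)
  moreover have "(((x, s), z), ((x \<otimes>\<^bsub>t_group\<^esub> in_t m, s), z * T_eval (\<lambda>k. - I m k) s)) \<in> LI_rel I"
    unfolding LI_rel_iff using xs by (auto simp: shift_def)
  ultimately show "p \<in> {((polar \<tau> v, z * multiplier v), (polar \<tau> w, c * multiplier w)) | v z w c. ((v, z), (w, c)) \<in> LI_rel I}"
    by blast
next
  fix p assume "p \<in> {((polar \<tau> v, z * multiplier v), (polar \<tau> w, c * multiplier w)) | v z w c. ((v, z), (w, c)) \<in> LI_rel I}"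
  then obtain x s z m where xs: "x \<in> carrier t_group" "s \<in> carrier T_group"
    and p: "p = ((polar \<tau> (x, s), z * multiplier (x, s)),
      (polar \<tau> (x \<otimes>\<^bsub>t_group\<^esub> in_t m, s), z * T_eval (\<lambda>k. - I m k) s * multiplier (x \<otimes>\<^bsub>t_group\<^esub> in_t m, s)))"
    by (auto simp: LI_rel_iff shift_def)
  have "p = ((polar \<tau> (x, s), z * multiplier (x, s)),
      (polar \<tau> (x, s) \<otimes>\<^bsub>TC_group\<^esub> q_pow \<tau> (in_t m),
        z * multiplier (x, s) * TC_eval (\<lambda>k. - I m k) (polar \<tau> (x, s)) * q_powr \<tau> (- (1/2) * of_int (I m m))))"
    using xs multiplier_shift [OF xs, of m] by (simp add: p polar_translate mult.assoc)
  then show "p \<in> Lo_rel \<tau> I"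
    unfolding Lo_rel_def using polar_closed [OF xs] by blast
qed

lemma bundle_iso:
  "line_bundle_iso_over base_map (LI_bundle I) (Looijenga_bundle \<tau> I)
     ((`) (\<lambda>(v, z). (polar \<tau> v, z * multiplier v)))"
  unfolding LI_bundle_def Looijenga_bundle_def torus_proj_def [symmetric]
proof (rule fibrewise_linear_rel.quotient_bundle_iso [OF fibrewise_linear_LI_rel homeomorphic_polar [OF \<tau>]
      continuous_multiplier _ homeomorphic_base_map _ Lo_rel_eq])
  fix v :: "('l, real) tensor \<times> ('l, complex) tensor"
  assume "v \<in> topspace (prod_topology t_top T_top)"
  then show "base_map (torus_proj v) = q_rel \<tau> `` {polar \<tau> v}"
    by (intro base_map_proj) auto
qed (auto simp: multiplier_def q_powr_def)

end

end

theorem lemma5p7: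
  fixes I :: "'l::ab_group_add \<Rightarrow> 'l \<Rightarrow> int" and \<tau> :: complex
  assumes "is_lattice (additive_group :: 'l monoid)"
    and "even_symmetric_form I"
    and "Im \<tau> > 0"
  shows "\<exists>\<beta> \<phi>. induced_base_map \<tau> \<beta> \<and>
           line_bundle_iso_over \<beta> (LI_bundle I) (Looijenga_bundle \<tau> I) \<phi>"
proof -
  obtain S and e :: "nat \<Rightarrow> 'l" and c where "lattice_basis S e c"
    using is_lattice_imp_basis [OF assms(1)] by blast
  then interpret lattice_form S e c I
    using assms(2) by (simp add: lattice_form_def lattice_form_axioms_def)
  show ?thesis
    using induced_base_map [OF assms(3)] bundle_iso [OF assms(3)] by blast
qed

end
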